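(* Let $\tau>0$ and let $\mathsf{H}_\tau=\{(x,y,z)\in\mathbb{R}^3_+: z=\tau\}$ be a horosphere of $\mathbb{H}^3$. (a) If $W$ is the slab between two parallel totally geodesic planes $\mathsf{P}_{\tau_1}$ and $\mathsf{P}_{\tau_2}$, $\tau_1<\tau_2$, then $\mathsf{H}_\tau\cap W$ is strongly stable as a capillary surface in $W$. (b) If $W$ is the wedge between two equidistant surfaces $\mathsf{E}_{\theta}$ and $\mathsf{E}_{-\theta}$, $\theta\in(0,\pi/2)$, then $\mathsf{H}_\tau\cap W$ is strongly stable as a capillary surface in $W$.
   Context: $\mathbb{H}^3$ is the upper half-space $\mathbb{R}^3_+=\{z>0\}$ with metric $\langle\cdot,\cdot\rangle=(dx^2+dy^2+dz^2)/z^2$. $\mathsf{P}_{a}=\{y=a\}\cap\mathbb{R}^3_+$ (a totally geodesic plane), and $\mathsf{E}_{\theta}=\{(x,y,z)\in\mathbb{R}^3_+: z=y\tan\theta\}$ (an equidistant surface). The slab is $W=\{\tau_1<y<\tau_2\}\cap\mathbb{R}^3_+$ and the wedge is $W=\{(x,y,z)\in\mathbb{R}^3_+: |y|<z/\tan\theta\}$. Capillary surfaces. Let $\Sigma\subset W$ be a surface with $\mathrm{int}(\Sigma)\subset\mathrm{int}(W)$, $\partial\Sigma\subset\partial W$, separating $W$ into two components; $D$ is one of them (here one may take $D=W\cap\{z>\tau\}$) and $\Omega=\partial D\cap\partial W$. $N$ is the unit normal of $\Sigma$ pointing into $D$, $\overline N$ the unit normal of $\Omega$ pointing out of $D$, $\nu,\overline\nu$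 the exterior unit conormals of $\partial\Sigma$ in $\Sigma$ and in $\Omega$. $\Sigma$ is capillary if it has constant mean curvature and the angle $\gamma$, $\cos\gamma=\langle N,\overline N\rangle$, is constant along each component of $\partial\Sigma$. With $A(X,Y)=-\langle\nabla_XN,Y\rangle$ the second fundamental form of $\Sigma$ and $\overline A$ that of $\partial W$ with respect to $-\overline N$, put $\mathbf{q}=\frac{1}{\sin\gamma}\overline A(\overline\nu,\overline\nu)+\cot\gamma A(\nu,\nu)$ along $\partial\Sigma$ and $$Q[u]=\int_\Sigma\left(|\nabla u|^2-(|A|^2-2)u^2\right)-\int_{\partial\Sigma}\mathbf{q}\,u^2 .$$ $\Sigma$ is strongly stable if its Morse index is $0$, equivalently $Q[u]\ge0$ for every smooth compactly supported $u$ on $\Sigma$ (not required to vanish on $\partial\Sigma$, and without any mean-zero condition). For non-compact $\Sigma$ the index is the limit of the indices along an exhaustion by bounded subdomains, test functions vanishing on the part of the boundary of the subdomain interior to $\Sigma$. *)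

theory Defs
  imports "HOL-Analysis.Analysis"
begin

section \<open>Smooth maps\<close>

text \<open>On an open set \<open>U\<close>, \<open>Ck_on k f U\<close> says that \<open>f\<close> is of class \<open>C^k\<close>; the clauses agree with the
  usual notion for finite-dimensional domains, the only case used here.\<close>

primrec Ck_on :: "nat \<Rightarrow> ('a::real_normed_vector \<Rightarrow> 'b::real_normed_vector) \<Rightarrow> 'a set \<Rightarrow> bool" where
  "Ck_on 0 f U \<longleftrightarrow> continuous_on U f"
| "Ck_on (Suc k) f U \<longleftrightarrow>
     f differentiable_on U \<and> (\<forall>v. Ck_on k (\<lambda>x. frechet_derivative f (at x) v) U)"

definition smooth_on :: "'a::real_normed_vector set \<Rightarrow> ('a \<Rightarrow> 'b::real_normed_vector) \<Rightarrow> bool" where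
  "smooth_on U f \<longleftrightarrow> open U \<and> (\<forall>k. Ck_on k f U)"

text \<open>Smooth functions and fields on a subset \<open>M\<close> are represented by maps of the ambient space
  that are smooth on a neighbourhood of \<open>M\<close>. Only their values on \<open>M\<close> matter below: they are only
  differentiated in directions tangent to \<open>M\<close>.\<close>

definition smooth_near :: "'a::real_normed_vector set \<Rightarrow> ('a \<Rightarrow> 'b::real_normed_vector) \<Rightarrow> bool" where
  "smooth_near M f \<longleftrightarrow> (\<exists>V. M \<subseteq> V \<and> smooth_on V f)"


section \<open>The upper half-space model\<close>

definition uhs :: "(real^3) set" where
  "uhs = {p. p $ 3 > 0}"

definition hmetric :: "real^3 \<Rightarrow> real^3 \<Rightarrow> real^3 \<Rightarrow> real" where
  "hmetric p v w = (v \<bullet> w) / (p $ 3)\<^sup>2"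

definition hgram :: "real^3 \<Rightarrow> real^3^3" where
  "hgram p = (\<chi> i j. hmetric p (axis i 1) (axis j 1))"

definition pderiv_at :: "3 \<Rightarrow> (real^3 \<Rightarrow> real) \<Rightarrow> real^3 \<Rightarrow> real" where
  "pderiv_at i f p = frechet_derivative f (at p) (axis i 1)"

text \<open>\<open>christoffel p k i j\<close> is the Christoffel symbol with upper index \<open>k\<close> and lower indices \<open>i\<close>, \<open>j\<close>.\<close>

definition christoffel :: "real^3 \<Rightarrow> 3 \<Rightarrow> 3 \<Rightarrow> 3 \<Rightarrow> real" where
  "christoffel p k i j = 1/2 * (\<Sum>l\<in>UNIV. matrix_inv (hgram p) $ k $ l *
     (pderiv_at i (\<lambda>q. hgram q $ j $ l) p + pderiv_at j (\<lambda>q. hgram q $ i $ l) p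
      - pderiv_at l (\<lambda>q. hgram q $ i $ j) p))"

text \<open>Levi-Civita covariant derivative at \<open>p\<close> of the vector field \<open>Y\<close> in the direction \<open>X\<close>.\<close>

definition nabla :: "(real^3 \<Rightarrow> real^3) \<Rightarrow> real^3 \<Rightarrow> real^3 \<Rightarrow> real^3" where
  "nabla Y p X = frechet_derivative Y (at p) X
     + (\<chi> k. \<Sum>i\<in>UNIV. \<Sum>j\<in>UNIV. christoffel p k i j * X $ i * Y p $ j)"

lemma hgram_eq: "hgram p = (1 / (p $ 3)\<^sup>2) *\<^sub>R mat 1"
  by (vector hgram_def hmetric_def mat_def inner_axis_axis)

lemma matrix_inv_hgram:
  assumes "p \<in> uhs"
  shows "matrix_inv (hgram p) = (p $ 3)\<^sup>2 *\<^sub>R mat 1"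
proof -
  define B :: "real^3^3" where "B = (p $ 3)\<^sup>2 *\<^sub>R mat 1"
  have "p $ 3 \<noteq> 0" using assms by (auto simp: uhs_def)
  then have B: "hgram p ** B = mat 1" "B ** hgram p = mat 1"
    by (simp_all add: B_def hgram_eq matrix_scalar_ac scalar_matrix_assoc[symmetric])
  then have "matrix_inv (hgram p) ** hgram p = mat 1"
    unfolding matrix_inv_def using someI[of "\<lambda>A'. hgram p ** A' = mat 1 \<and> A' ** hgram p = mat 1" B]
    by blast
  with B have "matrix_inv (hgram p) = B"
    by (metis matrix_mul_assoc matrix_mul_lid matrix_mul_rid)
  then show ?thesis by (simp add: B_def)
qed

lemma pderiv_hgram:
  assumes "p \<in> uhs"
  shows "pderiv_at i (\<lambda>q. hgram q $ j $ l) p = (if i = 3 \<and> j = l then - 2 / (p $ 3) ^ 3 else 0)"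
proof -
  have nz: "p $ 3 \<noteq> 0" using assms by (auto simp: uhs_def)
  have eq: "(\<lambda>q. hgram q $ j $ l) = (\<lambda>q. (if j = l then 1 else 0) * inverse ((q $ 3)\<^sup>2))"
    by (auto simp: hgram_eq mat_def divide_inverse)
  have d: "((\<lambda>q::real^3. q $ 3) has_derivative (\<lambda>v. v $ 3)) (at p)"
    by (rule bounded_linear_imp_has_derivative[OF bounded_linear_vec_nth])
  have "((\<lambda>q::real^3. (if j = l then 1 else 0) * inverse ((q $ 3)\<^sup>2)) has_derivative
      (\<lambda>v. (if j = l then 1 else 0) * (- 2 * v $ 3 / (p $ 3) ^ 3))) (at p)"
    by (rule derivative_eq_intros d refl | use nz in force
        | (rule ext, use nz in \<open>simp add: field_simps power2_eq_square power3_eq_cube\<close>))+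
  from frechet_derivative_at[OF this, symmetric] show ?thesis
    unfolding pderiv_at_def eq by (auto simp: axis_def)
qed

lemma nabla_uhs:
  assumes "p \<in> uhs"
  shows "nabla Y p X = frechet_derivative Y (at p) X - (X $ 3 / p $ 3) *\<^sub>R Y p
           - (Y p $ 3 / p $ 3) *\<^sub>R X + ((X \<bullet> Y p) / p $ 3) *\<^sub>R axis 3 1"
proof -
  have nz: "p $ 3 \<noteq> 0" using assms by (auto simp: uhs_def)
  show ?thesis
    unfolding nabla_def christoffel_def matrix_inv_hgram[OF assms] pderiv_hgram[OF assms]
    using nz
    by (simp add: vec_eq_iff forall_3 sum_3 mat_def axis_def inner_vec_def field_simps
        power2_eq_square power3_eq_cube)
qed


section \<open>Submanifolds of the half-space\<close>

text \<open>Initial velocities of curves that leave \<open>p\<close> and stay in \<open>M\<close> for small positive times. On a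
  submanifold with boundary this is the tangent space at interior points and the closed inward
  half-space of the tangent space at boundary points.\<close>

definition velocities :: "(real^3) set \<Rightarrow> real^3 \<Rightarrow> (real^3) set" where
  "velocities M p = {v. \<exists>c :: real \<Rightarrow> real^3. c 0 = p \<and>
     (c has_vector_derivative v) (at 0 within {0..}) \<and> eventually (\<lambda>t. c t \<in> M) (at_right 0)}"

definition tspace :: "(real^3) set \<Rightarrow> real^3 \<Rightarrow> (real^3) set" where
  "tspace M p = span (velocities M p)"

definition surface_interior_pt :: "(real^3) set \<Rightarrow> real^3 \<Rightarrow> bool" where
  "surface_interior_pt M p \<longleftrightarrow> p \<in> M \<and>
     (\<exists>V f :: real^3 \<Rightarrow> real. p \<in> V \<and> smooth_on V f \<and> frechet_derivative f (at p) \<noteq> (\<lambda>v. 0) \<and>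
        M \<inter> V = {q \<in> V. f q = 0})"

definition surface_boundary_pt :: "(real^3) set \<Rightarrow> real^3 \<Rightarrow> bool" where
  "surface_boundary_pt M p \<longleftrightarrow> p \<in> M \<and>
     (\<exists>V f g :: real^3 \<Rightarrow> real. p \<in> V \<and> smooth_on V f \<and> smooth_on V g \<and> g p = 0 \<and>
        (\<forall>a b. (\<forall>v. a * frechet_derivative f (at p) v + b * frechet_derivative g (at p) v = 0)
            \<longrightarrow> a = 0 \<and> b = 0) \<and>
        M \<inter> V = {q \<in> V. f q = 0 \<and> g q \<ge> 0})"

text \<open>Embedded smooth surfaces with (possibly empty) smooth boundary.\<close>

definition embedded_surface :: "(real^3) set \<Rightarrow> bool" where
  "embedded_surface M \<longleftrightarrow> M \<subseteq> uhs \<and> (\<forall>p\<in>M. surface_interior_pt M p \<or> surface_boundary_pt M p)"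

definition surface_boundary :: "(real^3) set \<Rightarrow> (real^3) set" where
  "surface_boundary M = {p. surface_boundary_pt M p}"

definition unit_normal_field :: "(real^3) set \<Rightarrow> (real^3 \<Rightarrow> real^3) \<Rightarrow> bool" where
  "unit_normal_field M N \<longleftrightarrow> smooth_near M N \<and>
     (\<forall>p\<in>M. hmetric p (N p) (N p) = 1 \<and> (\<forall>v\<in>tspace M p. hmetric p (N p) v = 0))"

text \<open>Exterior unit conormal in \<open>M\<close> of the boundary curve \<open>\<Gamma>\<close> of \<open>M\<close>.\<close>

definition conormal :: "(real^3) set \<Rightarrow> (real^3) set \<Rightarrow> real^3 \<Rightarrow> real^3" where
  "conormal M \<Gamma> p = (THE v. v \<in> tspace M p \<and> hmetric p v v = 1 \<and>
     (\<forall>w\<in>tspace \<Gamma> p. hmetric p v w = 0) \<and> - v \<in> velocities M p)"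

definition second_ff :: "(real^3 \<Rightarrow> real^3) \<Rightarrow> real^3 \<Rightarrow> real^3 \<Rightarrow> real^3 \<Rightarrow> real" where
  "second_ff N p X Y = - hmetric p (nabla N p X) Y"

definition onframe :: "(real^3) set \<Rightarrow> real^3 \<Rightarrow> (real^3) \<times> (real^3) \<Rightarrow> bool" where
  "onframe M p = (\<lambda>(e1, e2). span {e1, e2} = tspace M p \<and>
     hmetric p e1 e1 = 1 \<and> hmetric p e2 e2 = 1 \<and> hmetric p e1 e2 = 0)"

definition mean_curvature :: "(real^3) set \<Rightarrow> (real^3 \<Rightarrow> real^3) \<Rightarrow> real^3 \<Rightarrow> real" where
  "mean_curvature M N p = (let (e1, e2) = (SOME e. onframe M p e) in
     (second_ff N p e1 e1 + second_ff N p e2 e2) / 2)"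

definition second_ff_norm2 :: "(real^3) set \<Rightarrow> (real^3 \<Rightarrow> real^3) \<Rightarrow> real^3 \<Rightarrow> real" where
  "second_ff_norm2 M N p = (let (e1, e2) = (SOME e. onframe M p e) in
     (second_ff N p e1 e1)\<^sup>2 + (second_ff N p e1 e2)\<^sup>2
     + (second_ff N p e2 e1)\<^sup>2 + (second_ff N p e2 e2)\<^sup>2)"

definition surface_grad :: "(real^3) set \<Rightarrow> (real^3 \<Rightarrow> real) \<Rightarrow> real^3 \<Rightarrow> real^3" where
  "surface_grad M u p = (THE w. w \<in> tspace M p \<and>
     (\<forall>v\<in>tspace M p. hmetric p w v = frechet_derivative u (at p) v))"


section \<open>Riemannian measure\<close>

text \<open>Volume density of a parametrisation with respect to the hyperbolic metric.\<close>

definition vol_density :: "(real^'k \<Rightarrow> real^3) \<Rightarrow> real^'k \<Rightarrow> real" where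
  "vol_density \<phi> x = sqrt (det (\<chi> i j. hmetric (\<phi> x)
     (frechet_derivative \<phi> (at x) (axis i 1)) (frechet_derivative \<phi> (at x) (axis j 1)) :: real^'k^'k))"

text \<open>A patch is a Borel piece \<open>B\<close> of the domain of an injective immersion \<open>\<phi>\<close>.\<close>

definition patch :: "(real^'k \<Rightarrow> real^3) \<Rightarrow> (real^'k) set \<Rightarrow> bool" where
  "patch \<phi> B \<longleftrightarrow> B \<in> sets borel \<and> (\<exists>U. B \<subseteq> U \<and> smooth_on U \<phi> \<and> inj_on \<phi> U \<and>
     (\<forall>x\<in>U. inj (frechet_derivative \<phi> (at x))))"

text \<open>The Riemannian measure of dimension \<open>CARD('k)\<close> on an embedded submanifold \<open>M\<close> of that dimension:
  \<open>M\<close> is, up to a null set, a countable disjoint union of patches, so that the measure of a Borel set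
  is the supremum of the total measure of finitely many disjoint patches contained in it.\<close>

definition riem_measure :: "'k::finite itself \<Rightarrow> (real^3) set \<Rightarrow> (real^3) measure" where
  "riem_measure K M = measure_of M {E. E \<subseteq> M \<and> E \<in> sets borel}
     (\<lambda>E. SUP P \<in> {P :: ((real^'k \<Rightarrow> real^3) \<times> (real^'k) set) set. finite P \<and>
               (\<forall>(\<phi>, B)\<in>P. patch \<phi> B \<and> \<phi> ` B \<subseteq> E) \<and>
               disjoint_family_on (\<lambda>(\<phi>, B). \<phi> ` B) P}.
        \<Sum>(\<phi>, B)\<in>P. \<integral>\<^sup>+x\<in>B. ennreal (vol_density \<phi> x) \<partial>lborel)"


section \<open>Capillary surfaces\<close>

definition wetted :: "(real^3) set \<Rightarrow> (real^3) set \<Rightarrow> (real^3) set" where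
  "wetted W D = frontier D \<inter> frontier W \<inter> uhs"

definition contact_angle :: "(real^3 \<Rightarrow> real^3) \<Rightarrow> (real^3 \<Rightarrow> real^3) \<Rightarrow> real^3 \<Rightarrow> real" where
  "contact_angle N Nbar p = arccos (hmetric p (N p) (Nbar p))"

text \<open>\<open>W\<close> is an open region of the half-space with smooth boundary \<open>frontier W \<inter> uhs\<close>. The field \<open>N\<close> is the
  unit normal of \<open>\<Sigma>\<close> pointing into \<open>D\<close>, and \<open>Nbar\<close> the unit normal of the wetted part \<open>\<Omega>\<close> of the
  boundary of \<open>W\<close> pointing out of \<open>D\<close>. Their directions are prescribed away from the boundary curve of
  \<open>\<Sigma>\<close>, where \<open>N\<close> need not point into \<open>W\<close>, and hence by continuity everywhere. The contact angle is
  required to lie strictly between \<open>0\<close> and \<open>pi\<close>, since the stability form divides by its sine.\<close>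

definition capillary ::
  "(real^3) set \<Rightarrow> (real^3) set \<Rightarrow> (real^3) set \<Rightarrow> (real^3 \<Rightarrow> real^3) \<Rightarrow> (real^3 \<Rightarrow> real^3) \<Rightarrow> bool" where
  "capillary W \<Sigma> D N Nbar \<longleftrightarrow>
     open W \<and> W \<subseteq> uhs \<and>
     embedded_surface (frontier W \<inter> uhs) \<and> surface_boundary (frontier W \<inter> uhs) = {} \<and>
     embedded_surface \<Sigma> \<and> \<Sigma> - surface_boundary \<Sigma> \<subseteq> W \<and> surface_boundary \<Sigma> \<subseteq> frontier W \<and>
     card (components (W - \<Sigma>)) = 2 \<and> D \<in> components (W - \<Sigma>) \<and>
     unit_normal_field \<Sigma> N \<and> (\<forall>p\<in>\<Sigma> - surface_boundary \<Sigma>. N p \<in> velocities D p) \<and>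
     unit_normal_field (wetted W D) Nbar \<and>
     (\<forall>p\<in>wetted W D - surface_boundary \<Sigma>. - Nbar p \<in> velocities D p) \<and>
     mean_curvature \<Sigma> N constant_on \<Sigma> \<and>
     (\<forall>C\<in>components (surface_boundary \<Sigma>). contact_angle N Nbar constant_on C) \<and>
     (\<forall>p\<in>surface_boundary \<Sigma>. 0 < contact_angle N Nbar p \<and> contact_angle N Nbar p < pi)"

text \<open>The coefficient \<open>q\<close>; the second fundamental form of the boundary of \<open>W\<close> is taken with respect to
  the normal \<open>-Nbar\<close>.\<close>

definition q_coeff ::
  "(real^3) set \<Rightarrow> (real^3) set \<Rightarrow> (real^3) set \<Rightarrow> (real^3 \<Rightarrow> real^3) \<Rightarrow> (real^3 \<Rightarrow> real^3) \<Rightarrow> real^3 \<Rightarrow> real" where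
  "q_coeff W \<Sigma> D N Nbar p =
     (let \<gamma> = contact_angle N Nbar p;
          \<nu> = conormal \<Sigma> (surface_boundary \<Sigma>) p;
          \<nu>bar = conormal (wetted W D) (surface_boundary \<Sigma>) p
      in 1 / sin \<gamma> * second_ff (\<lambda>x. - Nbar x) p \<nu>bar \<nu>bar + cot \<gamma> * second_ff N p \<nu> \<nu>)"

text \<open>The stability form with both integrals restricted to a subdomain \<open>S\<close> of \<open>\<Sigma>\<close>.\<close>

definition stability_form ::
  "(real^3) set \<Rightarrow> (real^3) set \<Rightarrow> (real^3) set \<Rightarrow> (real^3 \<Rightarrow> real^3) \<Rightarrow> (real^3 \<Rightarrow> real^3)
    \<Rightarrow> (real^3) set \<Rightarrow> (real^3 \<Rightarrow> real) \<Rightarrow> real" where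
  "stability_form W \<Sigma> D N Nbar S u =
     (LINT p:S|riem_measure TYPE(2) \<Sigma>.
        hmetric p (surface_grad \<Sigma> u p) (surface_grad \<Sigma> u p)
        - (second_ff_norm2 \<Sigma> N p - 2) * (u p)\<^sup>2)
     - (LINT p:(surface_boundary \<Sigma> \<inter> S)|riem_measure TYPE(1) (surface_boundary \<Sigma>).
          q_coeff W \<Sigma> D N Nbar p * (u p)\<^sup>2)"

definition bounded_subdomain :: "(real^3) set \<Rightarrow> (real^3) set \<Rightarrow> bool" where
  "bounded_subdomain \<Sigma> S \<longleftrightarrow> openin (top_of_set \<Sigma>) S \<and> compact (closure S) \<and> closure S \<subseteq> \<Sigma>"

text \<open>Test functions vanish on the relative frontier of \<open>S\<close> in \<open>\<Sigma>\<close>, but not necessarily on the part of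
  the boundary of \<open>\<Sigma>\<close> contained in \<open>S\<close>.\<close>

definition test_fun :: "(real^3) set \<Rightarrow> (real^3 \<Rightarrow> real) \<Rightarrow> bool" where
  "test_fun S u \<longleftrightarrow> smooth_near (closure S) u \<and> (\<forall>p\<in>closure S - S. u p = 0)"

text \<open>The index of \<open>S\<close> is the largest dimension of a space of test functions on which the stability form
  is negative definite; such a space is given by a basis \<open>f 0, \<dots>, f (k - 1)\<close>.\<close>

definition morse_index_on ::
  "(real^3) set \<Rightarrow> (real^3) set \<Rightarrow> (real^3) set \<Rightarrow> (real^3 \<Rightarrow> real^3) \<Rightarrow> (real^3 \<Rightarrow> real^3)
    \<Rightarrow> (real^3) set \<Rightarrow> enat" where
  "morse_index_on W \<Sigma> D N Nbar S = Sup {enat k | k. \<exists>f :: nat \<Rightarrow> real^3 \<Rightarrow> real.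
     (\<forall>i<k. test_fun S (f i)) \<and>
     (\<forall>c :: nat \<Rightarrow> real. (\<exists>i<k. c i \<noteq> 0) \<longrightarrow>
        stability_form W \<Sigma> D N Nbar S (\<lambda>p. \<Sum>i<k. c i * f i p) < 0)}"

definition exhaustion :: "(real^3) set \<Rightarrow> (nat \<Rightarrow> (real^3) set) \<Rightarrow> bool" where
  "exhaustion \<Sigma> S \<longleftrightarrow> (\<forall>n. bounded_subdomain \<Sigma> (S n) \<and> closure (S n) \<subseteq> S (Suc n)) \<and> (\<Union>n. S n) = \<Sigma>"

definition has_morse_index ::
  "(real^3) set \<Rightarrow> (real^3) set \<Rightarrow> (real^3) set \<Rightarrow> (real^3 \<Rightarrow> real^3) \<Rightarrow> (real^3 \<Rightarrow> real^3)
    \<Rightarrow> enat \<Rightarrow> bool" where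
  "has_morse_index W \<Sigma> D N Nbar m \<longleftrightarrow> (\<exists>S. exhaustion \<Sigma> S) \<and>
     (\<forall>S. exhaustion \<Sigma> S \<longrightarrow> (\<lambda>n. morse_index_on W \<Sigma> D N Nbar (S n)) \<longlonglongrightarrow> m)"

text \<open>The fields \<open>N\<close> and \<open>Nbar\<close> are determined on \<open>\<Sigma>\<close> and on the wetted region, so that the existential
  quantifier only introduces names for them.\<close>

definition strongly_stable_capillary :: "(real^3) set \<Rightarrow> (real^3) set \<Rightarrow> (real^3) set \<Rightarrow> bool" where
  "strongly_stable_capillary W \<Sigma> D \<longleftrightarrow>
     (\<exists>N Nbar. capillary W \<Sigma> D N Nbar \<and> has_morse_index W \<Sigma> D N Nbar 0)"


section \<open>Horospheres, slabs and wedges\<close>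

definition horosphere :: "real \<Rightarrow> (real^3) set" where
  "horosphere \<tau> = {p \<in> uhs. p $ 3 = \<tau>}"

definition vertical_plane :: "real \<Rightarrow> (real^3) set" where
  "vertical_plane a = {p \<in> uhs. p $ 2 = a}"

definition equidistant_surface :: "real \<Rightarrow> (real^3) set" where
  "equidistant_surface \<theta> = {p \<in> uhs. p $ 3 = p $ 2 * tan \<theta>}"

definition slab :: "real \<Rightarrow> real \<Rightarrow> (real^3) set" where
  "slab a b = {p \<in> uhs. a < p $ 2 \<and> p $ 2 < b}"

definition wedge :: "real \<Rightarrow> (real^3) set" where
  "wedge \<theta> = {p \<in> uhs. \<bar>p $ 2\<bar> < p $ 3 / tan \<theta>}"

lemma open_slab: "open (slab a b)"
proof -
  have "slab a b = {p. 0 < p $ 3} \<inter> {p. a < p $ 2} \<inter> {p. p $ 2 < b}"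
    by (auto simp: slab_def uhs_def)
  then show ?thesis by (auto intro!: open_Int open_Collect_less continuous_intros)
qed

lemma open_wedge: "open (wedge \<theta>)"
proof -
  have "wedge \<theta> = {p. 0 < p $ 3} \<inter> {p. \<bar>p $ 2\<bar> < p $ 3 * inverse (tan \<theta>)}"
    by (auto simp: wedge_def uhs_def divide_inverse)
  then show ?thesis by (auto intro!: open_Int open_Collect_less continuous_intros)
qed

lemma in_closure_ray:
  fixes p v :: "'a::real_normed_vector"
  assumes "0 < \<delta>" "\<And>t. 0 < t \<Longrightarrow> t < \<delta> \<Longrightarrow> p + t *\<^sub>R v \<in> S"
  shows "p \<in> closure S"
proof -
  have "((\<lambda>t. p + t *\<^sub>R v) \<longlongrightarrow> p + 0 *\<^sub>R v) (at_right (0::real))"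
    by (intro tendsto_intros)
  moreover have "eventually (\<lambda>t. p + t *\<^sub>R v \<in> closure S) (at_right 0)"
    unfolding eventually_at_right_field using assms closure_subset[of S] by blast
  ultimately show ?thesis
    by (intro Lim_in_closed_set[of "closure S" "\<lambda>t. p + t *\<^sub>R v" "at_right 0"]) auto
qed

lemma frontier_slab:
  assumes "a < b"
  shows "frontier (slab a b) \<inter> uhs = vertical_plane a \<union> vertical_plane b"
proof (intro equalityI subsetI)
  fix p assume p: "p \<in> frontier (slab a b) \<inter> uhs"
  have "closure (slab a b) \<subseteq> {p. a \<le> p $ 2} \<inter> {p. p $ 2 \<le> b}"
    by (intro closure_minimal closed_Int closed_Collect_le continuous_intros) (auto simp: slab_def)
  with p show "p \<in> vertical_plane a \<union> vertical_plane b"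
    unfolding frontier_def interior_open[OF open_slab]
    by (fastforce simp: vertical_plane_def slab_def)
next
  fix p assume p: "p \<in> vertical_plane a \<union> vertical_plane b"
  then have u: "p \<in> uhs" "p \<notin> slab a b" by (auto simp: vertical_plane_def slab_def)
  have "p \<in> closure (slab a b)"
  proof (cases "p $ 2 = a")
    case True
    then show ?thesis using u assms
      by (intro in_closure_ray[of "b - a" p "axis 2 1"]) (auto simp: slab_def uhs_def axis_def)
  next
    case False
    then have "p $ 2 = b" using p by (auto simp: vertical_plane_def)
    then show ?thesis using u assms
      by (intro in_closure_ray[of "b - a" p "- axis 2 1"]) (auto simp: slab_def uhs_def axis_def)
  qed
  with u show "p \<in> frontier (slab a b) \<inter> uhs"
    by (auto simp: frontier_def interior_open open_slab)
qed

lemma frontier_wedge: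
  assumes "0 < \<theta>" "\<theta> < pi / 2"
  shows "frontier (wedge \<theta>) \<inter> uhs = equidistant_surface \<theta> \<union> equidistant_surface (- \<theta>)"
proof -
  have t: "tan \<theta> > 0" using assms by (rule tan_gt_zero)
  have eqd: "p \<in> equidistant_surface \<theta> \<union> equidistant_surface (- \<theta>)
      \<longleftrightarrow> p \<in> uhs \<and> \<bar>p $ 2\<bar> = p $ 3 / tan \<theta>" for p
  proof (cases "p $ 2 \<ge> 0")
    case True
    then have "tan \<theta> * p $ 2 \<ge> 0" using t by simp
    then show ?thesis using True t
      by (auto simp: equidistant_surface_def uhs_def field_simps mult_less_0_iff)
  next
    case False
    then have "tan \<theta> * p $ 2 < 0" using t by (simp add: mult_pos_neg)
    then show ?thesis using False t by (auto simp: equidistant_surface_def uhs_def field_simps)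
  qed
  show ?thesis
  proof (intro equalityI subsetI)
    fix p assume p: "p \<in> frontier (wedge \<theta>) \<inter> uhs"
    have "closure (wedge \<theta>) \<subseteq> {p. \<bar>p $ 2\<bar> \<le> p $ 3 * inverse (tan \<theta>)}"
      by (intro closure_minimal closed_Collect_le continuous_intros)
        (auto simp: wedge_def divide_inverse)
    with p show "p \<in> equidistant_surface \<theta> \<union> equidistant_surface (- \<theta>)"
      unfolding eqd frontier_def interior_open[OF open_wedge]
      by (fastforce simp: wedge_def divide_inverse)
  next
    fix p assume "p \<in> equidistant_surface \<theta> \<union> equidistant_surface (- \<theta>)"
    then have u: "p \<in> uhs" "\<bar>p $ 2\<bar> = p $ 3 / tan \<theta>" unfolding eqd by auto
    then have "p \<in> closure (wedge \<theta>)" using t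
      by (intro in_closure_ray[of 1 p "axis 3 1"])
        (auto simp: wedge_def uhs_def axis_def divide_strict_right_mono)
    with u show "p \<in> frontier (wedge \<theta>) \<inter> uhs"
      unfolding frontier_def interior_open[OF open_wedge] by (auto simp: wedge_def)
  qed
qed

end

theory Submission
  imports Defs
begin

text \<open>Both regions have the form \<open>\<bar>y - m\<bar> < h + k z\<close>: the slab has \<open>k = 0\<close>, the wedge has \<open>m = h = 0\<close> and
  \<open>k = cot \<theta>\<close>. Their walls are Euclidean planes that make the same angle with the vertical, so that
  one argument serves for both.

  A Euclidean plane with Euclidean unit normal \<open>w\<close> has hyperbolic unit normal \<open>z w\<close>, and the Levi-Civita
  connection of the half-space gives \<open>\<nabla>\<^sub>X (z w) = - w\<^sub>3 X\<close> for tangent \<open>X\<close>: the plane is umbilic with both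
  principal curvatures equal to \<open>w\<^sub>3\<close> (\<open>second_ff_scaled_field\<close>). For the horosphere \<open>w\<close> is vertical,
  hence \<open>A\<close> is the metric, \<open>H = 1\<close> and \<open>\<bar>A\<bar>\<^sup>2 = 2\<close>, and the potential \<open>\<bar>A\<bar>\<^sup>2 - 2\<close> vanishes. With
  \<open>s = sqrt (1 + k\<^sup>2)\<close> the outward normals of the walls are \<open>w = (0, \<plusminus>1, -k) / s\<close>. Thus \<open>cos \<gamma> = - k / s\<close>,
  \<open>sin \<gamma> = 1 / s\<close>, the curvature of the walls for the inward normal is \<open>k / s\<close>, and
  \<open>q = s * (k / s) + (- k) * 1 = 0\<close>
  (\<open>q_coeff_zero\<close>). The stability form is therefore \<open>\<integral>\<bar>\<nabla>u\<bar>\<^sup>2\<close>. This is nonnegative for every measure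
  and every \<open>u\<close>, so that no space of test functions makes it negative definite and the index of every
  subdomain is \<open>0\<close> (\<open>strongly_stable_capillaryI\<close>).

  It remains to see that the configuration is capillary. All surfaces and curves in it are pieces of
  planes and lines, so that tangent spaces and conormals come from two facts about \<open>velocities\<close>: straight
  rays give velocities (\<open>velocities_ray\<close>), and linear inequalities on the set bound them
  (\<open>velocity_inner_le\<close>). A first-derivative test separates interior points of a surface from boundary
  points (\<open>not_surface_boundary_pt\<close>), and convexity identifies the two components of the complement.\<close>

section \<open>Smooth maps, velocities and conormals\<close>

lemma Ck_on_locally_constant:
  assumes "open U" "\<And>x. x \<in> U \<Longrightarrow> (f has_derivative (\<lambda>_. 0)) (at x)"
  shows "Ck_on k f U"
  using assms(2)
proof (induction k arbitrary: f)
  case 0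
  then show ?case
    by (auto intro!: continuous_at_imp_continuous_on has_derivative_continuous)
next
  case (Suc k)
  have "((\<lambda>x. frechet_derivative f (at x) v) has_derivative (\<lambda>_. 0)) (at x)" if "x \<in> U" for x v
  proof (rule has_derivative_transform_within_open[OF has_derivative_const assms(1) that])
    show "0 = frechet_derivative f (at y) v" if "y \<in> U" for y
      using frechet_derivative_at[OF Suc.prems[OF that]] by metis
  qed
  then show ?case
    using Suc by (simp, meson differentiable_at_withinI differentiableI differentiable_on_def)
qed

text \<open>The derivative may jump from one component of \<open>U\<close> to another. This covers the normal of the walls,
  which is a different linear field on either side of the plane \<open>y = m\<close>.\<close>
lemma smooth_on_locally_affine:
  assumes "open U" and f: "\<And>x. x \<in> U \<Longrightarrow> (f has_derivative L x) (at x)"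
    and L: "\<And>x v. x \<in> U \<Longrightarrow> ((\<lambda>x. L x v) has_derivative (\<lambda>_. 0)) (at x)"
  shows "smooth_on U f"
proof -
  have "((\<lambda>x. frechet_derivative f (at x) v) has_derivative (\<lambda>_. 0)) (at x)" if "x \<in> U" for x v
  proof (rule has_derivative_transform_within_open[OF L[OF that] assms(1) that])
    show "L y v = frechet_derivative f (at y) v" if "y \<in> U" for y
      using frechet_derivative_at[OF f[OF that]] by simp
  qed
  moreover have "f differentiable_on U"
    using f by (meson differentiable_at_withinI differentiableI differentiable_on_def)
  ultimately have "Ck_on (Suc k) f U" for k
    using assms(1) by (simp add: Ck_on_locally_constant)
  moreover have "continuous_on U f"
    using f by (auto intro!: continuous_at_imp_continuous_on has_derivative_continuous)
  ultimately have "Ck_on k f U" for k by (cases k) auto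
  then show ?thesis using assms(1) by (simp add: smooth_on_def)
qed

lemma smooth_on_affine:
  assumes "open U" "\<And>x. (f has_derivative L) (at x)"
  shows "smooth_on U f"
  using assms by (intro smooth_on_locally_affine[of U f "\<lambda>_. L"]) auto

lemma has_derivative_vec_nth [derivative_intros]:
  "(f has_derivative f') F \<Longrightarrow> ((\<lambda>x. f x $ i) has_derivative (\<lambda>v. f' v $ i)) F"
  by (rule bounded_linear.has_derivative[OF bounded_linear_vec_nth])

text \<open>Along a curve that stays in \<open>M\<close> the linear function \<open>n\<close> has a maximum at the starting point, so that
  its one-sided derivative there is at most \<open>0\<close>.\<close>
lemma velocity_inner_le:
  assumes v: "v \<in> velocities M p" and V: "open V" "p \<in> V"
    and le: "\<And>q. q \<in> M \<Longrightarrow> q \<in> V \<Longrightarrow> n \<bullet> q \<le> n \<bullet> p"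
  shows "n \<bullet> v \<le> 0"
proof -
  obtain c :: "real \<Rightarrow> real^3" where c0: "c 0 = p"
    and c: "(c has_vector_derivative v) (at 0 within {0..})"
    and cM: "eventually (\<lambda>t. c t \<in> M) (at_right 0)"
    using v by (auto simp: velocities_def)
  have "((\<lambda>t. n \<bullet> c t) has_vector_derivative n \<bullet> v) (at 0 within {0..})"
    by (rule bounded_linear.has_vector_derivative[OF bounded_linear_inner_right c])
  then have "((\<lambda>t. (n \<bullet> c t - n \<bullet> c 0) / (t - 0)) \<longlongrightarrow> n \<bullet> v) (at 0 within {0..})"
    by (simp add: has_real_derivative_iff_has_vector_derivative[symmetric] has_field_derivative_iff)
  then have lim: "((\<lambda>t. (n \<bullet> c t - n \<bullet> p) / t) \<longlongrightarrow> n \<bullet> v) (at_right 0)"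
    by (simp add: c0 at_within_Ici_at_right)
  have "(c \<longlongrightarrow> p) (at_right 0)"
    using has_vector_derivative_continuous[OF c] c0
    by (simp add: continuous_within at_within_Ici_at_right)
  then have "eventually (\<lambda>t. c t \<in> V) (at_right 0)"
    using V by (rule topological_tendstoD)
  then have "eventually (\<lambda>t. (n \<bullet> c t - n \<bullet> p) / t \<le> 0) (at_right 0)"
    using cM eventually_at_right_less[of "0::real"]
    by eventually_elim (use le in \<open>auto simp: divide_nonpos_pos\<close>)
  then show ?thesis
    by (intro tendsto_upperbound[OF lim]) auto
qed

lemma velocity_inner_eq:
  assumes "v \<in> velocities M p" "open V" "p \<in> V"
    and "\<And>q. q \<in> M \<Longrightarrow> q \<in> V \<Longrightarrow> n \<bullet> q = n \<bullet> p"
  shows "n \<bullet> v = 0"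
  using velocity_inner_le[OF assms(1-3), of n] velocity_inner_le[OF assms(1-3), of "- n"] assms(4)
  by fastforce

lemma velocities_ray:
  assumes "0 < \<delta>" "\<And>t. 0 < t \<Longrightarrow> t < \<delta> \<Longrightarrow> p + t *\<^sub>R v \<in> M"
  shows "v \<in> velocities M p"
proof -
  have "((\<lambda>t. p + t *\<^sub>R v) has_vector_derivative v) (at 0 within {0..})"
    by (auto intro!: derivative_eq_intros)
  moreover have "eventually (\<lambda>t. p + t *\<^sub>R v \<in> M) (at_right 0)"
    using assms by (auto simp: eventually_at_right_field)
  ultimately show ?thesis
    unfolding velocities_def by (intro CollectI exI[of _ "\<lambda>t. p + t *\<^sub>R v"]) auto
qed

lemma smooth_on_imp_differentiable:
  assumes "smooth_on V f" "p \<in> V"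
  shows "f differentiable at p"
proof -
  have V: "open V" and "Ck_on (Suc 0) f V" using assms(1) unfolding smooth_on_def by blast+
  then have "f differentiable_on V" by simp
  then show ?thesis using assms(2) differentiable_on_eq_differentiable_at[OF V] by blast
qed

lemma surface_boundary_pt_mem: "surface_boundary_pt M p \<Longrightarrow> p \<in> M"
  unfolding surface_boundary_pt_def by (rule conjunct1)

lemma surface_interior_pt_affine:
  fixes f :: "real^3 \<Rightarrow> real"
  assumes "open V" "p \<in> M" "p \<in> V" and f: "\<And>x. (f has_derivative F) (at x)"
    and "F v \<noteq> 0" "M \<inter> V = {q \<in> V. f q = 0}"
  shows "surface_interior_pt M p"
proof -
  have "frechet_derivative f (at p) \<noteq> (\<lambda>v. 0)"
    using frechet_derivative_at[OF f, of p] assms(5) by metis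
  then show ?thesis
    unfolding surface_interior_pt_def
    by - (rule conjI[OF assms(2)], rule exI[of _ V], rule exI[of _ f],
      intro conjI smooth_on_affine[OF assms(1) f] assms(3,6))
qed

lemma surface_boundary_pt_affine:
  fixes f g :: "real^3 \<Rightarrow> real"
  assumes "open V" "p \<in> M" "p \<in> V"
    and f: "\<And>x. (f has_derivative F) (at x)" and g: "\<And>x. (g has_derivative G) (at x)"
    and indep: "\<And>a b. (\<forall>v. a * F v + b * G v = 0) \<Longrightarrow> a = 0 \<and> b = 0"
    and "g p = 0" "M \<inter> V = {q \<in> V. f q = 0 \<and> g q \<ge> 0}"
  shows "surface_boundary_pt M p"
proof -
  have "\<forall>a b. (\<forall>v. a * frechet_derivative f (at p) v + b * frechet_derivative g (at p) v = 0)
            \<longrightarrow> a = 0 \<and> b = 0"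
    using indep unfolding frechet_derivative_at[OF f, symmetric] frechet_derivative_at[OF g, symmetric]
    by (intro allI impI)
  then show ?thesis
    unfolding surface_boundary_pt_def
    by - (rule conjI[OF assms(2)], rule exI[of _ V], rule exI[of _ f], rule exI[of _ g],
      intro conjI smooth_on_affine[OF assms(1) f] smooth_on_affine[OF assms(1) g] assms(3,7,8))
qed

text \<open>If \<open>M\<close> were \<open>{f = 0, g \<ge> 0}\<close> near \<open>p\<close>, then on every line segment of \<open>M\<close> through \<open>p\<close> in its interior
  the function \<open>f\<close> would be constant and \<open>g\<close> would have a minimum at \<open>p\<close>. Two independent such directions
  leave only one dimension on which the differentials of \<open>f\<close> and \<open>g\<close> can be nonzero, so that these
  differentials are dependent.\<close>
lemma not_surface_boundary_pt:
  assumes \<delta>: "0 < \<delta>" and a: "\<And>t. \<bar>t\<bar> < \<delta> \<Longrightarrow> p + t *\<^sub>R a \<in> M"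
    and b: "\<And>t. \<bar>t\<bar> < \<delta> \<Longrightarrow> p + t *\<^sub>R b \<in> M"
    and span: "span {a, b, n} = UNIV"
  shows "\<not> surface_boundary_pt M p"
proof
  assume "surface_boundary_pt M p"
  from this[unfolded surface_boundary_pt_def, THEN conjunct2]
  obtain V and f g :: "real^3 \<Rightarrow> real"
    where V: "p \<in> V" "smooth_on V f" "smooth_on V g" "g p = 0"
      and indep: "\<forall>\<alpha> \<beta>. (\<forall>v. \<alpha> * frechet_derivative f (at p) v + \<beta> * frechet_derivative g (at p) v = 0)
            \<longrightarrow> \<alpha> = 0 \<and> \<beta> = 0"
      and M: "M \<inter> V = {q \<in> V. f q = 0 \<and> g q \<ge> 0}"
    by - (erule exE, erule exE, erule exE, elim conjE, rule that)
  have oV: "open V" using V by (simp add: smooth_on_def)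
  have diff: "f differentiable at p" "g differentiable at p"
    using V by (auto intro: smooth_on_imp_differentiable)
  define F where "F = frechet_derivative f (at p)"
  define G where "G = frechet_derivative g (at p)"
  have F: "(f has_derivative F) (at p)" and G: "(g has_derivative G) (at p)"
    using diff by (auto simp: F_def G_def frechet_derivative_works[symmetric])
  have lin: "linear F" "linear G" using F G by (auto intro: has_derivative_linear)
  have zero: "F w = 0 \<and> G w = 0" if w: "\<And>t. \<bar>t\<bar> < \<delta> \<Longrightarrow> p + t *\<^sub>R w \<in> M" for w
  proof -
    have "((\<lambda>t::real. p + t *\<^sub>R w) \<longlongrightarrow> p + 0 *\<^sub>R w) (nhds 0)"
      by (intro tendsto_intros filterlim_ident)
    then have "eventually (\<lambda>t::real. p + t *\<^sub>R w \<in> V) (nhds 0)"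
      using oV V(1) by (auto dest: topological_tendstoD)
    moreover have "eventually (\<lambda>t::real. \<bar>t\<bar> < \<delta>) (nhds 0)"
      using \<delta> unfolding eventually_nhds_metric by (auto simp: dist_real_def)
    ultimately have "eventually (\<lambda>t. f (p + t *\<^sub>R w) = 0 \<and> g (p + t *\<^sub>R w) \<ge> 0) (nhds 0)"
      by eventually_elim (use w M in auto)
    then obtain e where e: "0 < e" "\<And>t. \<bar>t\<bar> < e \<Longrightarrow> f (p + t *\<^sub>R w) = 0 \<and> g (p + t *\<^sub>R w) \<ge> 0"
      unfolding eventually_nhds_metric by (auto simp: dist_real_def)
    have line: "((\<lambda>t. \<phi> (p + t *\<^sub>R w)) has_real_derivative \<Phi> w) (at 0)"
      if "(\<phi> has_derivative \<Phi>) (at p)" for \<phi> \<Phi> :: "real^3 \<Rightarrow> real"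
    proof -
      have "((\<lambda>t. p + t *\<^sub>R w) has_derivative (\<lambda>t. t *\<^sub>R w)) (at 0)"
        by (auto intro!: derivative_eq_intros)
      from has_derivative_compose[OF this, of \<phi> \<Phi>] that
      have "((\<lambda>t. \<phi> (p + t *\<^sub>R w)) has_derivative (\<lambda>t. \<Phi> (t *\<^sub>R w))) (at 0)" by simp
      moreover have "\<Phi> (t *\<^sub>R w) = \<Phi> w * t" for t
        using has_derivative_linear[OF that] by (simp add: linear_scale)
      ultimately show ?thesis by (simp add: has_field_derivative_def)
    qed
    have "f p = 0" using V(1) M e(2)[of 0] e(1) by simp
    \<comment> \<open>Both functions attain a minimum at \<open>0\<close> along the line: \<open>f\<close> is constant there, and \<open>g\<close> is
      nonnegative and vanishes at \<open>p\<close>.\<close>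
    have "F w = 0"
      by (rule DERIV_local_min[OF line[OF F] e(1)]) (use e \<open>f p = 0\<close> in auto)
    moreover have "G w = 0"
      by (rule DERIV_local_min[OF line[OF G] e(1)]) (use e V in auto)
    ultimately show ?thesis ..
  qed
  have dep: "\<alpha> * F v + \<beta> * G v = 0" if "\<alpha> * F n + \<beta> * G n = 0" for \<alpha> \<beta> v
  proof -
    have "linear (\<lambda>v. \<alpha> * F v + \<beta> * G v)"
      using lin by (auto intro!: linearI simp: linear_add linear_scale algebra_simps)
    then show ?thesis
      by (rule linear_eq_0_on_span[of _ "{a, b, n}"]) (use that zero[of a] zero[of b] a b span in auto)
  qed
  \<comment> \<open>The combination with coefficients \<open>G n\<close> and \<open>- F n\<close> also vanishes on \<open>n\<close>; by independence both
    coefficients are \<open>0\<close>, and then \<open>F\<close> itself vanishes.\<close>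
  have indep': "\<alpha> = 0 \<and> \<beta> = 0" if "\<forall>v. \<alpha> * F v + \<beta> * G v = 0" for \<alpha> \<beta>
    using indep[rule_format, of \<alpha> \<beta>] that unfolding F_def G_def by blast
  have "G n = 0 \<and> - F n = 0"
    by (rule indep', rule allI, rule dep) simp
  then have "\<forall>v. 1 * F v + 0 * G v = 0"
    using dep[of 1 0] by simp
  from indep'[OF this] show False by simp
qed

text \<open>The unit vectors of the tangent plane orthogonal to the curve are \<open>\<nu>\<close> and \<open>- \<nu>\<close>; the condition on
  velocities selects the one that points out of \<open>M\<close>.\<close>
lemma conormal_eq:
  assumes p: "p \<in> uhs" and \<Gamma>: "tspace \<Gamma> p = span {e}" and M: "tspace M p = span {e, \<nu>}"
    and e: "e \<noteq> 0" "e \<bullet> \<nu> = 0" and unit: "hmetric p \<nu> \<nu> = 1"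
    and dir: "- \<nu> \<in> velocities M p" "\<nu> \<notin> velocities M p"
  shows "conormal M \<Gamma> p = \<nu>"
  unfolding conormal_def
proof (rule the_equality)
  have "hmetric p \<nu> w = 0" if "w \<in> tspace \<Gamma> p" for w
    using that e unfolding \<Gamma> by (auto simp: span_singleton hmetric_def inner_commute)
  then show "\<nu> \<in> tspace M p \<and> hmetric p \<nu> \<nu> = 1 \<and> (\<forall>w\<in>tspace \<Gamma> p. hmetric p \<nu> w = 0) \<and> - \<nu> \<in> velocities M p"
    using unit dir by (auto simp: M span_base)
next
  fix v assume v: "v \<in> tspace M p \<and> hmetric p v v = 1 \<and> (\<forall>w\<in>tspace \<Gamma> p. hmetric p v w = 0) \<and> - v \<in> velocities M p"
  have z: "p $ 3 > 0" using p by (simp add: uhs_def)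
  obtain \<alpha> \<beta> where ab: "v = \<alpha> *\<^sub>R e + \<beta> *\<^sub>R \<nu>"
    using v unfolding M span_insert span_singleton by (auto simp: algebra_simps)
  have "hmetric p v e = 0" using v by (auto simp: \<Gamma> span_base)
  then have "\<alpha> * (e \<bullet> e) = 0"
    using z e by (simp add: hmetric_def ab inner_simps inner_commute)
  then have v\<beta>: "v = \<beta> *\<^sub>R \<nu>" using e ab by simp
  have "\<beta> * \<beta> * hmetric p \<nu> \<nu> = hmetric p v v" by (simp add: v\<beta> hmetric_def)
  then have "\<beta> = 1 \<or> \<beta> = - 1" using v unit by (simp add: square_eq_1_iff)
  then show "v = \<nu>" using v dir by (auto simp: v\<beta>)
qed

section \<open>Umbilic planes and nonnegative stability forms\<close>

text \<open>Of the three correction terms of the connection, the one along \<open>w p\<close> cancels the derivative of the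
  factor \<open>z\<close>, and the vertical one vanishes because \<open>X\<close> is orthogonal to \<open>w p\<close>.\<close>
lemma second_ff_scaled_field:
  assumes p: "p \<in> uhs" and w: "(w has_derivative (\<lambda>_. 0)) (at p)" and X: "X \<bullet> w p = 0"
  shows "second_ff (\<lambda>q. q $ 3 *\<^sub>R w q) p X Y = w p $ 3 * hmetric p X Y"
proof -
  have "((\<lambda>q. q $ 3 *\<^sub>R w q) has_derivative (\<lambda>v. v $ 3 *\<^sub>R w p)) (at p)"
    using w by (auto intro!: derivative_eq_intros)
  from frechet_derivative_at[OF this, symmetric]
  have "nabla (\<lambda>q. q $ 3 *\<^sub>R w q) p X = - (w p $ 3) *\<^sub>R X"
    using p X by (simp add: nabla_uhs uhs_def)
  then show ?thesis by (simp add: second_ff_def hmetric_def)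
qed

lemma smooth_on_scaled_field:
  fixes w :: "real^3 \<Rightarrow> real^3"
  assumes "open U" "\<And>p. p \<in> U \<Longrightarrow> (w has_derivative (\<lambda>_. 0)) (at p)"
  shows "smooth_on U (\<lambda>q. q $ 3 *\<^sub>R w q)"
proof (rule smooth_on_locally_affine[where L = "\<lambda>q v. v $ 3 *\<^sub>R w q"])
  show "((\<lambda>q. q $ 3 *\<^sub>R w q) has_derivative (\<lambda>v. v $ 3 *\<^sub>R w x)) (at x)" if "x \<in> U" for x
    using assms(2)[OF that] by (auto intro!: derivative_eq_intros)
  show "((\<lambda>q. (v::real^3) $ 3 *\<^sub>R w q) has_derivative (\<lambda>_. 0)) (at x)" if "x \<in> U" for x v
    using assms(2)[OF that] by (auto intro!: derivative_eq_intros)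
qed (fact assms(1))

text \<open>Pointwise signs of the two integrands suffice: the Bochner integral of a nonnegative function is
  nonnegative, integrable or not, and whatever the measure is.\<close>
lemma strongly_stable_capillaryI:
  assumes cap: "capillary W \<Sigma> D N Nbar" and ex: "exhaustion \<Sigma> S0"
    and A: "\<And>p. p \<in> \<Sigma> \<Longrightarrow> second_ff_norm2 \<Sigma> N p \<le> 2"
    and q: "\<And>p. p \<in> surface_boundary \<Sigma> \<Longrightarrow> q_coeff W \<Sigma> D N Nbar p \<le> 0"
  shows "strongly_stable_capillary W \<Sigma> D"
proof -
  have nonneg: "stability_form W \<Sigma> D N Nbar S u \<ge> 0" if "S \<subseteq> \<Sigma>" for S u
  proof -
    have "(LINT p:S|riem_measure TYPE(2) \<Sigma>.
        hmetric p (surface_grad \<Sigma> u p) (surface_grad \<Sigma> u p)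
        - (second_ff_norm2 \<Sigma> N p - 2) * (u p)\<^sup>2) \<ge> 0"
      unfolding set_lebesgue_integral_def
    proof (intro Bochner_Integration.integral_nonneg)
      fix p
      show "0 \<le> indicat_real S p *\<^sub>R (hmetric p (surface_grad \<Sigma> u p) (surface_grad \<Sigma> u p)
          - (second_ff_norm2 \<Sigma> N p - 2) * (u p)\<^sup>2)"
      proof (cases "p \<in> S")
        case True
        then have "(second_ff_norm2 \<Sigma> N p - 2) * (u p)\<^sup>2 \<le> 0"
          using that A[of p] by (intro mult_nonpos_nonneg) auto
        moreover have "hmetric p (surface_grad \<Sigma> u p) (surface_grad \<Sigma> u p) \<ge> 0"
          by (simp add: hmetric_def)
        ultimately show ?thesis by simp
      qed simp
    qed
    moreover have "(LINT p:(surface_boundary \<Sigma> \<inter> S)|riem_measure TYPE(1) (surface_boundary \<Sigma>).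
        - (q_coeff W \<Sigma> D N Nbar p * (u p)\<^sup>2)) \<ge> 0"
      unfolding set_lebesgue_integral_def
      using q by (intro Bochner_Integration.integral_nonneg) (auto simp: indicator_def mult_nonpos_nonneg)
    ultimately show ?thesis by (simp add: stability_form_def set_lebesgue_integral_def)
  qed
  have idx: "morse_index_on W \<Sigma> D N Nbar S = 0" if "S \<subseteq> \<Sigma>" for S
  proof -
    have k0: "k = 0" if neg: "\<forall>c :: nat \<Rightarrow> real. (\<exists>i<k. c i \<noteq> 0) \<longrightarrow>
        stability_form W \<Sigma> D N Nbar S (\<lambda>p. \<Sum>i<k. c i * f i p) < 0" for k f
    proof (rule ccontr)
      assume "k \<noteq> 0"
      then have "stability_form W \<Sigma> D N Nbar S (\<lambda>p. \<Sum>i<k. 1 * f i p) < 0"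
        by (intro neg[rule_format]) auto
      with nonneg[OF \<open>S \<subseteq> \<Sigma>\<close>] show False by (meson not_less)
    qed
    show ?thesis
      unfolding morse_index_on_def
    proof (rule antisym)
      show "Sup {enat k |k. \<exists>f. (\<forall>i<k. test_fun S (f i)) \<and>
          (\<forall>c. (\<exists>i<k. c i \<noteq> 0) \<longrightarrow>
            stability_form W \<Sigma> D N Nbar S (\<lambda>p. \<Sum>i<k. c i * f i p) < 0)} \<le> 0"
        by (rule Sup_least) (clarify, drule k0, simp add: zero_enat_def)
    qed simp
  qed
  have "S n \<subseteq> \<Sigma>" if "exhaustion \<Sigma> S" for S n
    using that by (auto simp: exhaustion_def)
  then have "has_morse_index W \<Sigma> D N Nbar 0"
    using ex by (auto simp: has_morse_index_def idx)
  with cap show ?thesis by (auto simp: strongly_stable_capillary_def)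
qed

lemma hmetric_commute: "hmetric p v w = hmetric p w v"
  by (simp add: hmetric_def inner_commute)

text \<open>The definitions pick an arbitrary orthonormal frame; the existence of one makes the choice meaningful,
  and its vectors satisfy the assumption on \<open>N\<close> because they are tangent.\<close>
lemma umbilic_curvatures:
  assumes "onframe M p e0"
    and N: "\<And>X Y. X \<in> tspace M p \<Longrightarrow> second_ff N p X Y = hmetric p X Y"
  shows "mean_curvature M N p = 1" "second_ff_norm2 M N p = 2"
proof -
  obtain e1 e2 where e: "(SOME e. onframe M p e) = (e1, e2)" by fastforce
  have on: "onframe M p (e1, e2)" using someI[of "onframe M p", OF assms(1)] by (simp add: e)
  then have "e1 \<in> tspace M p" "e2 \<in> tspace M p"
    by (auto simp: onframe_def intro: span_base)
  then show "mean_curvature M N p = 1" "second_ff_norm2 M N p = 2"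
    using on hmetric_commute[of p e1 e2]
    by (simp_all add: mean_curvature_def second_ff_norm2_def e N) (simp_all add: onframe_def)
qed

lemma span_scaled_pair:
  fixes a b :: "'a::real_vector"
  assumes "c \<noteq> 0" "d \<noteq> 0"
  shows "span {c *\<^sub>R a, d *\<^sub>R b} = span {a, b}"
proof -
  have "a = (1 / c) *\<^sub>R (c *\<^sub>R a)" "b = (1 / d) *\<^sub>R (d *\<^sub>R b)" using assms by simp_all
  then have "a \<in> span {c *\<^sub>R a, d *\<^sub>R b}" "b \<in> span {c *\<^sub>R a, d *\<^sub>R b}"
    by (metis insertI1 insertI2 span_base span_mul)+
  then show ?thesis by (auto simp: span_eq intro: span_mul span_base)
qed

lemma span_pairE:
  fixes a b :: "'a::real_vector"
  assumes "v \<in> span {a, b}"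
  obtains \<alpha> \<beta> where "v = \<alpha> *\<^sub>R a + \<beta> *\<^sub>R b"
  using assms unfolding span_insert span_singleton by (auto simp: algebra_simps)

lemma span_pairI:
  fixes a b :: "'a::real_vector"
  shows "\<alpha> *\<^sub>R a + \<beta> *\<^sub>R b \<in> span {a, b}"
  by (intro span_add span_mul span_base) auto

lemma span_triple_UNIV:
  fixes a b c :: "'a::real_vector"
  assumes "\<And>v. v = \<alpha> v *\<^sub>R a + (\<beta> v *\<^sub>R b + \<gamma> v *\<^sub>R c)"
  shows "span {a, b, c} = UNIV"
proof (rule UNIV_eq_I[symmetric])
  fix v
  have "\<alpha> v *\<^sub>R a + (\<beta> v *\<^sub>R b + \<gamma> v *\<^sub>R c) \<in> span {a, b, c}"
    by (intro span_add span_mul span_base) auto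
  then show "v \<in> span {a, b, c}" using assms[of v] by simp
qed

section \<open>Horospheres in a tilted slab\<close>

text \<open>The case \<open>h = k = 0\<close> is excluded, so that the region has positive width \<open>2 * (h + k * z)\<close> at every
  height \<open>z > 0\<close>. The walls then do not meet inside the half-space.\<close>
locale tilted_slab =
  fixes m h k \<tau> :: real
  assumes h: "0 \<le> h" and k: "0 \<le> k" and hk: "0 < h + k" and \<tau>: "0 < \<tau>"
begin

definition region :: "(real^3) set" where
  "region = {p \<in> uhs. \<bar>p $ 2 - m\<bar> < h + k * p $ 3}"

definition strip :: "(real^3) set" where
  "strip = {p. p $ 3 = \<tau> \<and> \<bar>p $ 2 - m\<bar> \<le> h + k * \<tau>}"

definition above :: "(real^3) set" where
  "above = region \<inter> {p. p $ 3 > \<tau>}"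

definition rim :: "(real^3) set" where
  "rim = {p. p $ 3 = \<tau> \<and> \<bar>p $ 2 - m\<bar> = h + k * \<tau>}"

definition wet :: "(real^3) set" where
  "wet = {p. \<tau> \<le> p $ 3 \<and> \<bar>p $ 2 - m\<bar> = h + k * p $ 3}"

text \<open>The Euclidean length of \<open>(0, \<plusminus>1, -k)\<close> and of the vector \<open>(0, \<plusminus>k, 1)\<close> along the walls.\<close>
definition s :: real where "s = sqrt (1 + k\<^sup>2)"

text \<open>The sign extends the Euclidean outward normals of the two walls to one field that is locally constant
  off the plane \<open>y = m\<close>.\<close>
definition wallnormal :: "real^3 \<Rightarrow> real^3" where
  "wallnormal p = (1 / s) *\<^sub>R vector [0, sgn (p $ 2 - m), - k]"

definition up :: "real^3 \<Rightarrow> real^3" where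
  "up p = p $ 3 *\<^sub>R axis 3 1"

definition out :: "real^3 \<Rightarrow> real^3" where
  "out p = p $ 3 *\<^sub>R wallnormal p"

lemma s_pos: "0 < s" and s2: "s * s = 1 + k * k"
  by (auto simp: s_def power2_eq_square add_pos_nonneg intro!: real_sqrt_mult_self)

lemma width_pos: "0 < z \<Longrightarrow> 0 < h + k * z"
  using h k hk by (cases "h = 0") (auto intro: add_pos_nonneg)

text \<open>The number \<open>\<epsilon>\<close> records on which of the two walls a point lies; most computations below are linear once it
  is fixed.\<close>
lemma side:
  assumes "\<bar>x\<bar> = h + k * z" "0 < z"
  obtains \<epsilon> :: real where "\<epsilon> = 1 \<or> \<epsilon> = - 1" "\<epsilon> * x = h + k * z" "sgn x = \<epsilon>"
  using assms width_pos[of z] by (cases "x > 0") (force simp: sgn_if)+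

lemma abs_eq_side: "\<epsilon> = 1 \<or> \<epsilon> = - 1 \<Longrightarrow> \<epsilon> * x = \<rho> \<Longrightarrow> 0 \<le> \<rho> \<Longrightarrow> \<bar>x\<bar> = \<rho>" for x \<epsilon> \<rho> :: real
  by auto

lemma open_region: "open region"
proof -
  have "region = {p. 0 < p $ 3} \<inter> {p. \<bar>p $ 2 - m\<bar> < h + k * p $ 3}"
    by (auto simp: region_def uhs_def)
  then show ?thesis by (auto intro!: open_Int open_Collect_less continuous_intros)
qed

lemma convex_region: "convex region"
proof -
  have "region = {p. inner (axis 3 1) p > 0} \<inter> {p. inner (axis 2 1 - k *\<^sub>R axis 3 1) p < h + m}
      \<inter> {p. inner (- axis 2 1 - k *\<^sub>R axis 3 1) p < h - m}"
    by (auto simp: region_def uhs_def inner_diff_left inner_axis' abs_less_iff)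
  then show ?thesis
    by (simp only:) (intro convex_Int convex_halfspace_lt convex_halfspace_gt)
qed

lemma abs_towards: "t \<le> 1 \<Longrightarrow> \<bar>y + t * (m - y) - m\<bar> = (1 - t) * \<bar>y - m\<bar>"
proof -
  assume "t \<le> 1"
  moreover have "y + t * (m - y) - m = (1 - t) * (y - m)" by (simp add: algebra_simps)
  ultimately show ?thesis by (simp add: abs_mult)
qed

text \<open>A point with weak inequality is approached from inside along the horizontal segment towards the plane
  \<open>y = m\<close>.\<close>
lemma mem_closure_region:
  assumes "p \<in> uhs"
  shows "p \<in> closure region \<longleftrightarrow> \<bar>p $ 2 - m\<bar> \<le> h + k * p $ 3"
proof
  assume p: "p \<in> closure region"
  have "closure region \<subseteq> {p. \<bar>p $ 2 - m\<bar> \<le> h + k * p $ 3}"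
    by (intro closure_minimal closed_Collect_le continuous_intros) (auto simp: region_def)
  with p show "\<bar>p $ 2 - m\<bar> \<le> h + k * p $ 3" by auto
next
  assume le: "\<bar>p $ 2 - m\<bar> \<le> h + k * p $ 3"
  have pos: "0 < h + k * p $ 3" using assms by (simp add: uhs_def width_pos)
  show "p \<in> closure region"
  proof (rule in_closure_ray[of 1 p "(m - p $ 2) *\<^sub>R axis 2 1"])
    fix t :: real assume t: "0 < t" "t < 1"
    have "\<bar>p $ 2 + t * (m - p $ 2) - m\<bar> = (1 - t) * \<bar>p $ 2 - m\<bar>"
      using t by (intro abs_towards) simp
    also have "\<dots> \<le> (1 - t) * (h + k * p $ 3)" using le t by (intro mult_left_mono) auto
    also have "\<dots> < 1 * (h + k * p $ 3)" using pos t by (intro mult_strict_right_mono) auto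
    finally show "p + t *\<^sub>R (m - p $ 2) *\<^sub>R axis 2 1 \<in> region"
      using assms by (simp add: region_def uhs_def axis_def)
  qed simp
qed

lemma frontier_region: "frontier region \<inter> uhs = {p \<in> uhs. \<bar>p $ 2 - m\<bar> = h + k * p $ 3}"
proof -
  have "p \<in> frontier region \<longleftrightarrow> \<bar>p $ 2 - m\<bar> = h + k * p $ 3" if "p \<in> uhs" for p
    using that mem_closure_region[OF that]
    by (auto simp: frontier_def interior_open[OF open_region]) (auto simp: region_def)
  then show ?thesis by auto
qed

text \<open>A point of a wall at height at least \<open>\<tau>\<close> is approached from \<open>above\<close> by moving upwards and towards the
  plane \<open>y = m\<close> at the same time; the upward motion is needed at height exactly \<open>\<tau>\<close>.\<close>
lemma wetted_eq: "wetted region above = wet"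
proof -
  have oa: "open above"
    unfolding above_def by (intro open_Int open_region open_Collect_less continuous_intros)
  have "closure above \<subseteq> {p. \<tau> \<le> p $ 3}"
    by (intro closure_minimal closed_Collect_le continuous_intros) (auto simp: above_def)
  then have "wetted region above \<subseteq> wet"
    using frontier_region by (auto simp: wetted_def wet_def frontier_def)
  moreover have "p \<in> wetted region above" if p: "p \<in> wet" for p
  proof -
    have u: "p \<in> uhs" and z: "\<tau> \<le> p $ 3" and eq: "\<bar>p $ 2 - m\<bar> = h + k * p $ 3"
      using p \<tau> by (auto simp: wet_def uhs_def)
    have "p \<in> closure above"
    proof (rule in_closure_ray[of 1 p "vector [0, m - p $ 2, 1]"])
      fix t :: real assume t: "0 < t" "t < 1"
      have "\<bar>p $ 2 + t * (m - p $ 2) - m\<bar> = (1 - t) * \<bar>p $ 2 - m\<bar>"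
        using t by (intro abs_towards) simp
      also have "\<dots> < 1 * (h + k * p $ 3)"
        unfolding eq using t u by (intro mult_strict_right_mono width_pos) (auto simp: uhs_def)
      also have "\<dots> \<le> h + k * (p $ 3 + t)" using k t by (simp add: algebra_simps)
      finally show "p + t *\<^sub>R vector [0, m - p $ 2, 1] \<in> above"
        using u z t by (simp add: above_def region_def uhs_def)
    qed simp
    moreover have "p \<notin> above" using eq by (simp add: above_def region_def)
    ultimately have "p \<in> frontier above" by (simp add: frontier_def interior_open oa)
    then show ?thesis using frontier_region u eq by (auto simp: wetted_def)
  qed
  ultimately show ?thesis by blast
qed

lemma horosphere_eq: "horosphere \<tau> \<inter> closure region = strip"
  using \<tau> mem_closure_region by (auto simp: horosphere_def strip_def uhs_def)

lemma components_minus_strip: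
  "components (region - strip) = {above, region \<inter> {p. p $ 3 < \<tau>}}"
  "above \<noteq> region \<inter> {p. p $ 3 < \<tau>}"
proof -
  have "vector [0, m, 2 * \<tau>] \<in> above" "vector [0, m, \<tau> / 2] \<in> region \<inter> {p. p $ 3 < \<tau>}"
    using \<tau> width_pos[of "2 * \<tau>"] width_pos[of "\<tau> / 2"]
    by (auto simp: above_def region_def uhs_def)
  moreover have disj: "above \<inter> (region \<inter> {p. p $ 3 < \<tau>}) = {}" by (auto simp: above_def)
  ultimately show "above \<noteq> region \<inter> {p. p $ 3 < \<tau>}" by auto
  have hs: "{p :: real^3. p $ 3 < \<tau>} = {p. inner (axis 3 1) p < \<tau>}"
    "{p :: real^3. p $ 3 > \<tau>} = {p. inner (axis 3 1) p > \<tau>}"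
    by (auto simp: inner_axis')
  show "components (region - strip) = {above, region \<inter> {p. p $ 3 < \<tau>}}"
  proof (rule components_open_unique)
    show "pairwise disjnt {above, region \<inter> {p. p $ 3 < \<tau>}}"
      using disj by (auto simp: pairwise_insert disjnt_def)
    show "\<Union> {above, region \<inter> {p. p $ 3 < \<tau>}} = region - strip"
      by (auto simp: above_def region_def strip_def)
    fix X assume X: "X \<in> {above, region \<inter> {p. p $ 3 < \<tau>}}"
    have "convex X" using X unfolding above_def hs
      by (auto intro!: convex_Int convex_region convex_halfspace_lt convex_halfspace_gt)
    moreover have "open X" using X unfolding above_def
      by (auto intro!: open_Int open_region open_Collect_less continuous_intros)
    ultimately show "open X \<and> connected X \<and> X \<noteq> {}"
      using X \<open>vector [0, m, 2 * \<tau>] \<in> above\<close> \<open>vector [0, m, \<tau> / 2] \<in> region \<inter> {p. p $ 3 < \<tau>}\<close>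
      by (auto simp: convex_connected)
  qed
qed

lemma wet_strip_rim_uhs: "wet \<subseteq> uhs" "strip \<subseteq> uhs" "rim \<subseteq> uhs"
  using \<tau> by (auto simp: wet_def strip_def rim_def uhs_def)

lemma rim_subset: "rim \<subseteq> strip" "rim \<subseteq> wet"
  by (auto simp: rim_def strip_def wet_def)

section \<open>Tangent spaces and unit normals\<close>

lemma e1_velocities:
  assumes "\<And>t. p + t *\<^sub>R axis 1 1 \<in> M"
  shows "axis 1 1 \<in> velocities M p"
  using assms by (intro velocities_ray[of 1]) auto

text \<open>On an edge of the strip only one of \<open>\<plusminus>axis 2 1\<close> is a velocity, namely the one towards \<open>y = m\<close>; the span
  is the full tangent plane all the same.\<close>
lemma tspace_strip:
  assumes p: "p \<in> strip"
  shows "tspace strip p = span {axis 1 1, axis 2 1}"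
  unfolding tspace_def span_eq
proof
  show "velocities strip p \<subseteq> span {axis 1 1, axis 2 1}"
  proof
    fix v assume "v \<in> velocities strip p"
    then have "axis 3 1 \<bullet> v = 0"
      by (rule velocity_inner_eq[of _ _ _ UNIV]) (use p in \<open>auto simp: strip_def inner_axis'\<close>)
    then have "v = v $ 1 *\<^sub>R axis 1 1 + v $ 2 *\<^sub>R axis 2 1"
      by (simp add: vec_eq_iff forall_3 inner_vec_def sum_3 axis_def)
    then show "v \<in> span {axis 1 1, axis 2 1}" by (metis span_pairI)
  qed
  have e1: "axis 1 1 \<in> velocities strip p"
    by (rule e1_velocities) (use p in \<open>auto simp: strip_def axis_def\<close>)
  define \<sigma> :: real where "\<sigma> = (if p $ 2 \<le> m then 1 else - 1)"
  have "\<sigma> *\<^sub>R axis 2 1 \<in> velocities strip p"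
    by (rule velocities_ray[of "h + k * \<tau>"])
      (use p \<tau> width_pos[of \<tau>] in \<open>auto simp: strip_def axis_def \<sigma>_def\<close>)
  then have "\<sigma> *\<^sub>R \<sigma> *\<^sub>R axis 2 1 \<in> span (velocities strip p)" by (intro span_mul span_base)
  then show "{axis 1 1, axis 2 1} \<subseteq> span (velocities strip p)"
    using e1 by (auto simp: \<sigma>_def span_base split: if_splits)
qed

lemma tspace_rim:
  assumes p: "p \<in> rim"
  shows "tspace rim p = span {axis 1 1}"
  unfolding tspace_def span_eq
proof
  obtain \<epsilon> :: real where \<epsilon>: "\<epsilon> = 1 \<or> \<epsilon> = - 1" "\<epsilon> * (p $ 2 - m) = h + k * \<tau>"
    using p \<tau> side[of "p $ 2 - m" \<tau>] by (auto simp: rim_def)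
  show "velocities rim p \<subseteq> span {axis 1 1}"
  proof
    fix v assume v: "v \<in> velocities rim p"
    from v have v3: "axis 3 1 \<bullet> v = 0"
      by (rule velocity_inner_eq[of _ _ _ UNIV]) (use p in \<open>auto simp: rim_def inner_axis'\<close>)
    from v have v2: "axis 2 1 \<bullet> v = 0"
    proof (rule velocity_inner_eq[of _ _ _ "{q. 0 < \<epsilon> * (q $ 2 - m)}"])
      show "open {q :: real^3. 0 < \<epsilon> * (q $ 2 - m)}"
        by (intro open_Collect_less continuous_intros)
    qed (use p \<epsilon> \<tau> width_pos[of \<tau>] in \<open>auto simp: rim_def inner_axis'\<close>)
    have "v = v $ 1 *\<^sub>R axis 1 1"
      using v2 v3 by (simp add: vec_eq_iff forall_3 inner_vec_def sum_3 axis_def)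
    then show "v \<in> span {axis 1 1}" by (metis span_base span_mul insertI1)
  qed
  have "axis 1 1 \<in> velocities rim p"
    by (rule e1_velocities) (use p in \<open>auto simp: rim_def axis_def\<close>)
  then show "{axis 1 1} \<subseteq> span (velocities rim p)" by (auto intro: span_base)
qed

text \<open>The vector \<open>(0, \<epsilon> * k, 1)\<close> is the direction of steepest ascent in the wall on the side \<open>\<epsilon>\<close>.\<close>
lemma wall_direction_velocity:
  assumes p: "p \<in> wet" and \<epsilon>: "\<epsilon> = 1 \<or> \<epsilon> = - 1" "\<epsilon> * (p $ 2 - m) = h + k * p $ 3" and c: "0 < c"
  shows "c *\<^sub>R vector [0, \<epsilon> * k, 1] \<in> velocities wet p"
proof (rule velocities_ray[of 1])
  fix t :: real assume "0 < t"
  then have t: "0 < t * c" using c by simp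
  have z: "0 < p $ 3" using p \<tau> by (auto simp: wet_def)
  have "\<epsilon> * (p $ 2 + t * (c * (\<epsilon> * k)) - m) = h + k * (p $ 3 + t * c)"
    using \<epsilon> by (auto simp: algebra_simps)
  moreover have "0 < h + k * (p $ 3 + t * c)" using z t by (intro width_pos) simp
  ultimately have "\<bar>p $ 2 + t * (c * (\<epsilon> * k)) - m\<bar> = h + k * (p $ 3 + t * c)"
    using \<epsilon>(1) by (intro abs_eq_side) auto
  then show "p + t *\<^sub>R c *\<^sub>R vector [0, \<epsilon> * k, 1] \<in> wet"
    using p t by (simp add: wet_def)
qed simp

lemma tspace_wet:
  assumes p: "p \<in> wet" and \<epsilon>: "\<epsilon> = 1 \<or> \<epsilon> = - 1" "\<epsilon> * (p $ 2 - m) = h + k * p $ 3"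
  shows "tspace wet p = span {axis 1 1, vector [0, \<epsilon> * k, 1]}"
  unfolding tspace_def span_eq
proof
  have pos: "0 < h + k * p $ 3" using p \<tau> by (intro width_pos) (auto simp: wet_def)
  show "velocities wet p \<subseteq> span {axis 1 1, vector [0, \<epsilon> * k, 1]}"
  proof
    fix v assume "v \<in> velocities wet p"
    then have "(\<epsilon> *\<^sub>R axis 2 1 - k *\<^sub>R axis 3 1) \<bullet> v = 0"
    proof (rule velocity_inner_eq[of _ _ _ "{q. 0 < \<epsilon> * (q $ 2 - m)}"])
      show "open {q :: real^3. 0 < \<epsilon> * (q $ 2 - m)}"
        by (intro open_Collect_less continuous_intros)
      show "(\<epsilon> *\<^sub>R axis 2 1 - k *\<^sub>R axis 3 1) \<bullet> q = (\<epsilon> *\<^sub>R axis 2 1 - k *\<^sub>R axis 3 1) \<bullet> p"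
        if "q \<in> wet" "q \<in> {q. 0 < \<epsilon> * (q $ 2 - m)}" for q
        using that \<epsilon> by (auto simp: wet_def inner_diff_left inner_axis' abs_if algebra_simps split: if_splits)
    qed (use \<epsilon> pos in auto)
    then have "\<epsilon> * v $ 2 = k * v $ 3" by (simp add: inner_diff_left inner_axis')
    then have "v $ 2 = \<epsilon> * k * v $ 3" using \<epsilon>(1) by auto
    then have "v = v $ 1 *\<^sub>R axis 1 1 + v $ 3 *\<^sub>R vector [0, \<epsilon> * k, 1]"
      by (simp add: vec_eq_iff forall_3 axis_def)
    then show "v \<in> span {axis 1 1, vector [0, \<epsilon> * k, 1]}" by (metis span_pairI)
  qed
  have "axis 1 1 \<in> velocities wet p"
    by (rule e1_velocities) (use p in \<open>auto simp: wet_def axis_def\<close>)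
  moreover have "vector [0, \<epsilon> * k, 1] \<in> velocities wet p"
    using wall_direction_velocity[OF p \<epsilon>, of 1] by simp
  ultimately show "{axis 1 1, vector [0, \<epsilon> * k, 1]} \<subseteq> span (velocities wet p)"
    by (auto intro: span_base)
qed

lemma wallnormal_locally_constant:
  assumes "p $ 2 \<noteq> m"
  shows "(wallnormal has_derivative (\<lambda>_. 0)) (at p)"
proof (rule has_derivative_transform_within_open[OF has_derivative_const[of "wallnormal p"]])
  show "open {q :: real^3. 0 < (p $ 2 - m) * (q $ 2 - m)}"
    by (intro open_Collect_less continuous_intros)
  show "wallnormal p = wallnormal q" if "q \<in> {q. 0 < (p $ 2 - m) * (q $ 2 - m)}" for q
    using that by (auto simp: wallnormal_def sgn_if zero_less_mult_iff)
qed (use assms in \<open>auto simp flip: power2_eq_square\<close>)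

lemma wallnormal_side:
  "sgn (p $ 2 - m) = \<epsilon> \<Longrightarrow> wallnormal p = (1 / s) *\<^sub>R vector [0, \<epsilon>, - k]"
  by (simp add: wallnormal_def)

lemma unit_normal_up: "unit_normal_field strip up"
  unfolding unit_normal_field_def
proof (intro conjI ballI)
  have "smooth_on UNIV up"
    unfolding up_def by (intro smooth_on_scaled_field) auto
  then show "smooth_near strip up" by (auto simp: smooth_near_def)
  fix p assume p: "p \<in> strip"
  then show "hmetric p (up p) (up p) = 1"
    using \<tau> by (simp add: hmetric_def up_def strip_def inner_axis' power2_eq_square)
  fix v assume "v \<in> tspace strip p"
  then show "hmetric p (up p) v = 0"
    unfolding tspace_strip[OF p]
    by (elim span_pairE) (simp add: hmetric_def up_def inner_vec_def sum_3 axis_def)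
qed

lemma wet_ne_centre: "p \<in> wet \<Longrightarrow> p $ 2 \<noteq> m"
  using \<tau> width_pos[of "p $ 3"] by (auto simp: wet_def)

lemma unit_normal_out: "unit_normal_field wet out"
  unfolding unit_normal_field_def
proof (intro conjI ballI)
  have "open {p :: real^3. p $ 2 \<noteq> m}"
    by (intro open_Collect_neq continuous_intros)
  then have "smooth_on {p. p $ 2 \<noteq> m} out"
    unfolding out_def by (intro smooth_on_scaled_field) (auto intro: wallnormal_locally_constant)
  moreover have "wet \<subseteq> {p. p $ 2 \<noteq> m}" using wet_ne_centre by blast
  ultimately show "smooth_near wet out" unfolding smooth_near_def by blast
  fix p assume p: "p \<in> wet"
  obtain \<epsilon> where \<epsilon>: "\<epsilon> = 1 \<or> \<epsilon> = - 1" "\<epsilon> * (p $ 2 - m) = h + k * p $ 3" "sgn (p $ 2 - m) = \<epsilon>"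
    using p \<tau> side[of "p $ 2 - m" "p $ 3"] by (auto simp: wet_def)
  have "vector [0, \<epsilon>, - k] \<bullet> (vector [0, \<epsilon>, - k] :: real^3) = s * s"
    using \<epsilon>(1) by (auto simp: inner_vec_def sum_3 s2)
  then show "hmetric p (out p) (out p) = 1"
    using p \<tau> s_pos unfolding out_def wallnormal_side[OF \<epsilon>(3)]
    by (auto simp: hmetric_def wet_def power2_eq_square)
  fix v assume "v \<in> tspace wet p"
  then show "hmetric p (out p) v = 0"
    unfolding tspace_wet[OF p \<epsilon>(1,2)] out_def wallnormal_side[OF \<epsilon>(3)]
    by (elim span_pairE) (use \<epsilon>(1) in \<open>auto simp: hmetric_def inner_vec_def sum_3 axis_def\<close>)
qed

section \<open>Interior and boundary points\<close>

lemma strip_rim_not_boundary: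
  assumes p: "p \<in> strip - rim"
  shows "\<not> surface_boundary_pt strip p"
proof (rule not_surface_boundary_pt[where a = "axis 1 1" and b = "axis 2 1" and n = "axis 3 1"])
  show "0 < h + k * \<tau> - \<bar>p $ 2 - m\<bar>" using p by (auto simp: strip_def rim_def)
  show "p + t *\<^sub>R axis 1 1 \<in> strip" if "\<bar>t\<bar> < h + k * \<tau> - \<bar>p $ 2 - m\<bar>" for t
    using p by (simp add: strip_def axis_def)
  show "p + t *\<^sub>R axis 2 1 \<in> strip" if "\<bar>t\<bar> < h + k * \<tau> - \<bar>p $ 2 - m\<bar>" for t
    using p that by (auto simp: strip_def axis_def)
  show "span {axis 1 1, axis 2 1, axis 3 1 :: real^3} = UNIV"
    by (rule span_triple_UNIV[of "\<lambda>v. v $ 1" _ "\<lambda>v. v $ 2" _ "\<lambda>v. v $ 3"])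
      (simp add: vec_eq_iff forall_3 axis_def)
qed

lemma strip_interior_pt:
  assumes p: "p \<in> strip - rim"
  shows "surface_interior_pt strip p"
proof -
  define V :: "(real^3) set" where "V = {q. \<bar>q $ 2 - m\<bar> < h + k * \<tau>}"
  have oV: "open V" unfolding V_def by (intro open_Collect_less continuous_intros)
  have f: "((\<lambda>q::real^3. q $ 3 - \<tau>) has_derivative (\<lambda>v. v $ 3)) (at x)" for x
    by (auto intro!: derivative_eq_intros)
  have "\<bar>p $ 2 - m\<bar> < h + k * \<tau>"
    using p unfolding strip_def rim_def by auto
  then have "p \<in> V" by (simp add: V_def)
  have eq: "strip \<inter> V = {q \<in> V. q $ 3 - \<tau> = 0}"
    by (auto simp: V_def strip_def)
  show ?thesis
    by (rule surface_interior_pt_affine[OF oV _ \<open>p \<in> V\<close> f _ eq, where v = "axis 3 1"])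
      (use p in \<open>auto simp: axis_def\<close>)
qed

lemma rim_boundary_pt:
  assumes p: "p \<in> rim"
  shows "surface_boundary_pt strip p"
proof -
  obtain \<epsilon> :: real where \<epsilon>: "\<epsilon> = 1 \<or> \<epsilon> = - 1" "\<epsilon> * (p $ 2 - m) = h + k * \<tau>"
    using p \<tau> side[of "p $ 2 - m" \<tau>] by (auto simp: rim_def)
  \<comment> \<open>The neighbourhood excludes the opposite edge, so that inside it the strip is cut out by one
    inequality.\<close>
  define V :: "(real^3) set" where "V = {q. - (h + k * \<tau>) < \<epsilon> * (q $ 2 - m)}"
  have oV: "open V" unfolding V_def by (intro open_Collect_less continuous_intros)
  have f: "((\<lambda>q::real^3. q $ 3 - \<tau>) has_derivative (\<lambda>v. v $ 3)) (at x)" for x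
    by (auto intro!: derivative_eq_intros)
  have g: "((\<lambda>q::real^3. h + k * \<tau> - \<epsilon> * (q $ 2 - m)) has_derivative (\<lambda>v. - (\<epsilon> * v $ 2))) (at x)" for x
    by (auto intro!: derivative_eq_intros)
  have indep: "a = 0 \<and> b = 0" if "\<forall>v::real^3. a * v $ 3 + b * - (\<epsilon> * v $ 2) = 0" for a b
    using that[rule_format, of "axis 3 1"] that[rule_format, of "axis 2 1"] \<epsilon>(1)
    by (auto simp: axis_def)
  have eq: "strip \<inter> V = {q \<in> V. q $ 3 - \<tau> = 0 \<and> h + k * \<tau> - \<epsilon> * (q $ 2 - m) \<ge> 0}"
    using \<epsilon>(1) by (auto simp: V_def strip_def)
  show ?thesis
  proof (rule surface_boundary_pt_affine[OF oV _ _ f g indep _ eq])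
    show "p \<in> strip" using p rim_subset by blast
    show "p \<in> V" using \<epsilon>(2) width_pos[OF \<tau>] unfolding V_def mem_Collect_eq by linarith
    show "h + k * \<tau> - \<epsilon> * (p $ 2 - m) = 0" using \<epsilon>(2) by simp
  qed
qed

lemma surface_boundary_strip: "surface_boundary strip = rim"
proof (intro equalityI subsetI)
  fix p assume "p \<in> surface_boundary strip"
  then have p: "surface_boundary_pt strip p" by (simp add: surface_boundary_def)
  then show "p \<in> rim"
    using strip_rim_not_boundary[of p] surface_boundary_pt_mem[OF p] by blast
qed (simp add: surface_boundary_def rim_boundary_pt)

lemma embedded_strip: "embedded_surface strip"
  using wet_strip_rim_uhs(2) strip_interior_pt rim_boundary_pt unfolding embedded_surface_def by blast

lemma wall_point:
  assumes p: "p \<in> frontier region \<inter> uhs"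
  shows "surface_interior_pt (frontier region \<inter> uhs) p"
    "\<not> surface_boundary_pt (frontier region \<inter> uhs) p"
proof -
  have z: "0 < p $ 3" and eq: "\<bar>p $ 2 - m\<bar> = h + k * p $ 3"
    using p unfolding frontier_region by (auto simp: uhs_def)
  then obtain \<epsilon> :: real where \<epsilon>: "\<epsilon> = 1 \<or> \<epsilon> = - 1" "\<epsilon> * (p $ 2 - m) = h + k * p $ 3"
    using side by metis
  define V :: "(real^3) set" where "V = {q. 0 < q $ 3} \<inter> {q. 0 < \<epsilon> * (q $ 2 - m)}"
  define f :: "real^3 \<Rightarrow> real" where "f = (\<lambda>q. \<epsilon> * (q $ 2 - m) - h - k * q $ 3)"
  have oV: "open V" unfolding V_def by (intro open_Int open_Collect_less continuous_intros)
  have f: "(f has_derivative (\<lambda>v. \<epsilon> * v $ 2 - k * v $ 3)) (at x)" for x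
    unfolding f_def by (auto intro!: derivative_eq_intros)
  have "p \<in> V" using z \<epsilon>(2) width_pos[OF z] by (simp add: V_def)
  moreover have "\<bar>q $ 2 - m\<bar> = \<epsilon> * (q $ 2 - m)" if "q \<in> V" for q
    using that \<epsilon>(1) by (auto simp: V_def)
  then have "(frontier region \<inter> uhs) \<inter> V = {q \<in> V. f q = 0}"
    unfolding frontier_region by (auto simp: f_def) (simp_all add: V_def uhs_def)
  ultimately show "surface_interior_pt (frontier region \<inter> uhs) p"
    using p \<epsilon>(1) by (intro surface_interior_pt_affine[OF oV _ _ f, where v = "axis 2 1"])
      (auto simp: axis_def)
  show "\<not> surface_boundary_pt (frontier region \<inter> uhs) p"
  proof (rule not_surface_boundary_pt[OF z, where a = "axis 1 1" and b = "vector [0, \<epsilon> * k, 1]" and n = "axis 2 1"])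
    show "p + t *\<^sub>R axis 1 1 \<in> frontier region \<inter> uhs" for t
      unfolding frontier_region using z eq by (simp add: uhs_def axis_def)
    show "p + t *\<^sub>R vector [0, \<epsilon> * k, 1] \<in> frontier region \<inter> uhs" if "\<bar>t\<bar> < p $ 3" for t
    proof -
      have t: "0 < p $ 3 + t" using that by linarith
      have "\<epsilon> * (p $ 2 + t * (\<epsilon> * k) - m) = h + k * (p $ 3 + t)"
        using \<epsilon> by (auto simp: algebra_simps)
      then have "\<bar>p $ 2 + t * (\<epsilon> * k) - m\<bar> = h + k * (p $ 3 + t)"
        using \<epsilon>(1) width_pos[OF t] by (intro abs_eq_side) auto
      then show ?thesis unfolding frontier_region using t by (simp add: uhs_def)
    qed
    show "span {axis 1 1, vector [0, \<epsilon> * k, 1], axis 2 1 :: real^3} = UNIV"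
      by (rule span_triple_UNIV[of "\<lambda>v. v $ 1" _ "\<lambda>v. v $ 3" _ "\<lambda>v. v $ 2 - v $ 3 * (\<epsilon> * k)"])
        (simp add: vec_eq_iff forall_3 axis_def)
  qed
qed

section \<open>Curvature and the boundary coefficient\<close>

lemma second_ff_up:
  assumes p: "p \<in> strip" and X: "X \<in> tspace strip p"
  shows "second_ff up p X Y = hmetric p X Y"
proof -
  have "X \<bullet> axis 3 1 = 0"
    using X unfolding tspace_strip[OF p] by (elim span_pairE) (simp add: inner_vec_def sum_3 axis_def)
  then show ?thesis
    using second_ff_scaled_field[of p "\<lambda>_. axis 3 1" X Y] p wet_strip_rim_uhs
    by (auto simp: up_def[abs_def])
qed

lemma curvatures_strip:
  assumes p: "p \<in> strip"
  shows "mean_curvature strip up p = 1" "second_ff_norm2 strip up p = 2"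
proof -
  have z: "p $ 3 = \<tau>" using p by (simp add: strip_def)
  have "onframe strip p (\<tau> *\<^sub>R axis 1 1, \<tau> *\<^sub>R axis 2 1)"
    unfolding onframe_def tspace_strip[OF p]
    using \<tau> z by (simp add: span_scaled_pair hmetric_def inner_axis_axis power2_eq_square)
  from umbilic_curvatures[OF this second_ff_up[OF p]]
  show "mean_curvature strip up p = 1" "second_ff_norm2 strip up p = 2" by blast+
qed

lemma contact_angle_rim:
  assumes p: "p \<in> rim"
  shows "contact_angle up out p = arccos (- k / s)"
  using p \<tau> by (simp add: contact_angle_def hmetric_def up_def out_def wallnormal_def rim_def
      inner_axis' power2_eq_square)

lemma angle_bounds: "\<bar>- k / s\<bar> < 1"
proof -
  have "k < s" unfolding s_def using k by (intro real_less_rsqrt) simp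
  then show ?thesis using k s_pos by simp
qed

text \<open>The exterior conormals at the edge on the side \<open>\<epsilon>\<close> are \<open>\<nu>\<close>, horizontal and away from \<open>y = m\<close>, and \<open>\<mu>\<close>,
  straight down the wall. Both surfaces are umbilic, so that only the curvatures \<open>1\<close> and \<open>k / s\<close> and the
  angle enter.\<close>
lemma q_coeff_zero:
  assumes p: "p \<in> rim"
  shows "q_coeff region strip above up out p = 0"
proof -
  have ps: "p \<in> strip" and pw: "p \<in> wet" and pu: "p \<in> uhs" and z: "p $ 3 = \<tau>"
    using p rim_subset wet_strip_rim_uhs by (auto simp: rim_def)
  obtain \<epsilon> where \<epsilon>: "\<epsilon> = 1 \<or> \<epsilon> = - 1" "\<epsilon> * (p $ 2 - m) = h + k * p $ 3" "sgn (p $ 2 - m) = \<epsilon>"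
    using pw \<tau> side[of "p $ 2 - m" "p $ 3"] by (auto simp: wet_def)
  have r: "0 < h + k * \<tau>" using \<tau> by (rule width_pos)
  define \<nu> :: "real^3" where "\<nu> = (\<epsilon> * \<tau>) *\<^sub>R axis 2 1"
  define \<mu> :: "real^3" where "\<mu> = (- (\<tau> / s)) *\<^sub>R vector [0, \<epsilon> * k, 1]"
  have "vector [0, \<epsilon> * k, 1] \<bullet> (vector [0, \<epsilon> * k, 1] :: real^3) = s * s"
    using \<epsilon>(1) by (auto simp: inner_vec_def sum_3 s2)
  then have \<mu>_unit: "hmetric p \<mu> \<mu> = 1"
    using \<tau> z s_pos by (simp add: hmetric_def \<mu>_def power2_eq_square)
  have e0: "axis 1 1 \<noteq> (0 :: real^3)" by (simp add: axis_eq_0_iff)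
  have \<nu>: "conormal strip rim p = \<nu>"
  proof (rule conormal_eq[OF pu tspace_rim[OF p] _ e0])
    show "tspace strip p = span {axis 1 1, \<nu>}"
      using span_scaled_pair[of 1 "\<epsilon> * \<tau>" "axis 1 1 :: real^3" "axis 2 1"] \<tau> \<epsilon>(1)
      by (auto simp: tspace_strip[OF ps] \<nu>_def)
    show "axis 1 1 \<bullet> \<nu> = 0" by (simp add: \<nu>_def inner_axis_axis)
    show "hmetric p \<nu> \<nu> = 1" using \<tau> z \<epsilon>(1)
      by (auto simp: hmetric_def \<nu>_def inner_axis_axis power2_eq_square)
    show "- \<nu> \<in> velocities strip p"
    proof (rule velocities_ray[of "2 * (h + k * \<tau>) / \<tau>"])
      fix t assume t: "0 < t" "t < 2 * (h + k * \<tau>) / \<tau>"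
      then have "0 < t * \<tau>" "t * \<tau> < 2 * (h + k * \<tau>)" using \<tau> by (auto simp: field_simps)
      then show "p + t *\<^sub>R - \<nu> \<in> strip"
        using z \<epsilon> by (auto simp: strip_def \<nu>_def axis_def)
    qed (use r \<tau> in simp)
    show "\<nu> \<notin> velocities strip p"
    proof
      assume "\<nu> \<in> velocities strip p"
      then have "(\<epsilon> *\<^sub>R axis 2 1) \<bullet> \<nu> \<le> 0"
        by (rule velocity_inner_le[of _ _ _ UNIV])
          (use \<epsilon> z in \<open>auto simp: strip_def inner_axis'\<close>)
      then show False using \<epsilon>(1) \<tau> by (auto simp: \<nu>_def inner_axis_axis)
    qed
  qed
  have \<mu>: "conormal wet rim p = \<mu>"
  proof (rule conormal_eq[OF pu tspace_rim[OF p] _ e0])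
    show "tspace wet p = span {axis 1 1, \<mu>}"
      using span_scaled_pair[of 1 "- (\<tau> / s)" "axis 1 1 :: real^3" "vector [0, \<epsilon> * k, 1]"] \<tau> s_pos
      by (simp add: tspace_wet[OF pw \<epsilon>(1,2)] \<mu>_def)
    show "axis 1 1 \<bullet> \<mu> = 0" by (simp add: \<mu>_def inner_axis')
    show "hmetric p \<mu> \<mu> = 1" by (fact \<mu>_unit)
    show "- \<mu> \<in> velocities wet p"
      using wall_direction_velocity[OF pw \<epsilon>(1,2), of "\<tau> / s"] \<tau> s_pos by (simp add: \<mu>_def)
    \<comment> \<open>The wetted region lies at heights at least \<open>\<tau>\<close>, while \<open>\<mu>\<close> points down.\<close>
    show "\<mu> \<notin> velocities wet p"
    proof
      assume "\<mu> \<in> velocities wet p"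
      then have "(- axis 3 1) \<bullet> \<mu> \<le> 0"
        by (rule velocity_inner_le[of _ _ _ UNIV]) (use z in \<open>auto simp: wet_def inner_axis'\<close>)
      then show False using \<tau> s_pos by (simp add: \<mu>_def inner_axis' divide_le_0_iff)
    qed
  qed
  have A: "second_ff up p \<nu> \<nu> = 1"
    using \<tau> z \<epsilon>(1) ps
    by (subst second_ff_up[OF ps])
      (auto simp: tspace_strip \<nu>_def hmetric_def inner_axis_axis power2_eq_square intro: span_mul span_base)
  have B: "second_ff (\<lambda>x. - out x) p \<mu> \<mu> = k / s"
  proof -
    have "((\<lambda>x. - wallnormal x) has_derivative (\<lambda>_. 0)) (at p)"
      using wallnormal_locally_constant[OF wet_ne_centre[OF pw]] by (auto intro!: derivative_eq_intros)
    moreover have "\<mu> \<bullet> - wallnormal p = 0"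
      unfolding wallnormal_side[OF \<epsilon>(3)] using \<epsilon>(1) by (auto simp: \<mu>_def inner_vec_def sum_3)
    ultimately have "second_ff (\<lambda>x. x $ 3 *\<^sub>R - wallnormal x) p \<mu> \<mu> = (- wallnormal p) $ 3 * hmetric p \<mu> \<mu>"
      by (rule second_ff_scaled_field[OF pu])
    then show ?thesis by (simp add: \<mu>_unit out_def[abs_def] wallnormal_def)
  qed
  have "1 - (- k / s)\<^sup>2 = (s * s - k * k) / (s * s)"
    using s_pos by (simp add: power2_eq_square diff_divide_distrib)
  also have "\<dots> = (1 / s)\<^sup>2" using s2 by (simp add: power2_eq_square)
  finally have "1 - (- k / s)\<^sup>2 = (1 / s)\<^sup>2" .
  then have sin: "sin (arccos (- k / s)) = 1 / s"
    using angle_bounds s_pos by (subst sin_arccos_abs) (auto simp: real_sqrt_divide)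
  moreover have "cos (arccos (- k / s)) = - k / s"
    using angle_bounds by (intro cos_arccos_abs) simp
  ultimately show ?thesis
    unfolding q_coeff_def surface_boundary_strip wetted_eq contact_angle_rim[OF p] \<nu> \<mu> A B Let_def
    using s_pos by (simp add: cot_def)
qed

section \<open>The capillary configuration\<close>

lemma exhaustion_strip: "exhaustion strip (\<lambda>n. strip \<inter> {p. \<bar>p $ 1\<bar> < real n})"
  unfolding exhaustion_def bounded_subdomain_def
proof (intro conjI allI)
  fix n
  let ?S = "\<lambda>n. strip \<inter> {p. \<bar>p $ 1\<bar> < real n}"
  define B :: "(real^3) set" where
    "B = cbox (vector [- real n, m - (h + k * \<tau>), \<tau>]) (vector [real n, m + (h + k * \<tau>), \<tau>])"
  have B: "B = strip \<inter> {p. \<bar>p $ 1\<bar> \<le> real n}"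
    by (auto simp: B_def mem_box_cart forall_3 strip_def)
  have "closed B" "bounded B" by (auto simp: B_def)
  have "closure (?S n) \<subseteq> B"
    using \<open>closed B\<close> by (intro closure_minimal) (auto simp: B)
  with \<open>bounded B\<close> show "compact (closure (?S n))"
    by (meson bounded_subset closed_closure compact_eq_bounded_closed)
  show "closure (?S n) \<subseteq> strip" "closure (?S n) \<subseteq> ?S (Suc n)"
    using \<open>closure (?S n) \<subseteq> B\<close> by (auto simp: B)
  show "openin (top_of_set strip) (?S n)"
    by (intro openin_open_Int open_Collect_less continuous_intros)
next
  show "(\<Union>n. strip \<inter> {p. \<bar>p $ 1\<bar> < real n}) = strip"
    using reals_Archimedean2 by auto
qed

lemma capillary_strip: "capillary region strip above up out"
  unfolding capillary_def surface_boundary_strip wetted_eq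
proof (intro conjI)
  show "open region" "region \<subseteq> uhs" using open_region by (auto simp: region_def)
  show "embedded_surface (frontier region \<inter> uhs)"
    using wall_point(1) by (simp add: embedded_surface_def)
  show "surface_boundary (frontier region \<inter> uhs) = {}"
    using wall_point(2) surface_boundary_pt_mem by (fastforce simp: surface_boundary_def)
  show "strip - rim \<subseteq> region" using \<tau> by (auto simp: strip_def rim_def region_def uhs_def)
  show "rim \<subseteq> frontier region"
    using frontier_region \<tau> by (auto simp: rim_def uhs_def)
  show "card (components (region - strip)) = 2" "above \<in> components (region - strip)"
    using components_minus_strip by auto
  show "\<forall>p\<in>strip - rim. up p \<in> velocities above p"
  proof
    fix p assume p: "p \<in> strip - rim"
    show "up p \<in> velocities above p"
    proof (rule velocities_ray[of 1])
      fix t :: real assume t: "0 < t"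
      have z: "p $ 3 = \<tau>" and "\<bar>p $ 2 - m\<bar> < h + k * \<tau>" using p by (auto simp: strip_def rim_def)
      moreover have "0 < t * \<tau>" "0 \<le> k * (t * \<tau>)" using t \<tau> k by auto
      ultimately show "p + t *\<^sub>R up p \<in> above"
        using \<tau> by (auto simp: above_def region_def uhs_def up_def axis_def algebra_simps)
    qed simp
  qed
  show "\<forall>p\<in>wet - rim. - out p \<in> velocities above p"
  proof
    fix p assume p: "p \<in> wet - rim"
    then have z: "\<tau> < p $ 3" by (auto simp: wet_def rim_def order_le_less)
    obtain \<epsilon> where \<epsilon>: "\<epsilon> = 1 \<or> \<epsilon> = - 1" "\<epsilon> * (p $ 2 - m) = h + k * p $ 3" "sgn (p $ 2 - m) = \<epsilon>"
      using p \<tau> side[of "p $ 2 - m" "p $ 3"] by (auto simp: wet_def)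
    define c where "c = p $ 3 / s"
    have c: "0 < c" using z \<tau> s_pos by (simp add: c_def)
    have r: "0 < h + k * p $ 3" using z \<tau> by (intro width_pos) simp
    \<comment> \<open>Within this range of \<open>t\<close> the inward ray from one wall does not reach the plane \<open>y = m\<close>.\<close>
    show "- out p \<in> velocities above p"
    proof (rule velocities_ray[of "(h + k * p $ 3) / c"])
      fix t assume t: "0 < t" "t < (h + k * p $ 3) / c"
      then have tc: "0 < t * c" "t * c < h + k * p $ 3" using c by (auto simp: field_simps)
      have kt: "0 \<le> t * c * k" "0 \<le> k * (t * c * k)" using tc k by auto
      have "p + t *\<^sub>R - out p = p + (t * c) *\<^sub>R vector [0, - \<epsilon>, k]"
        unfolding out_def wallnormal_side[OF \<epsilon>(3)] by (simp add: vec_eq_iff forall_3 c_def)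
      moreover have "\<bar>p $ 2 - t * c * \<epsilon> - m\<bar> < h + k * (p $ 3 + t * c * k)"
        using \<epsilon>(1,2) tc kt by (auto simp: algebra_simps)
      ultimately show "p + t *\<^sub>R - out p \<in> above"
        using z \<tau> kt by (simp add: above_def region_def uhs_def)
    qed (use r c in simp)
  qed
  show "mean_curvature strip up constant_on strip"
    using curvatures_strip by (auto simp: constant_on_def)
  show "\<forall>C\<in>components rim. contact_angle up out constant_on C"
    unfolding constant_on_def using contact_angle_rim in_components_subset by blast
  show "\<forall>p\<in>rim. 0 < contact_angle up out p \<and> contact_angle up out p < pi"
    using contact_angle_rim arccos_lt_bounded[of "- k / s"] angle_bounds[THEN abs_less_iff[THEN iffD1]]
    by auto
qed (fact embedded_strip unit_normal_up unit_normal_out)+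

lemma strongly_stable: "strongly_stable_capillary region (horosphere \<tau> \<inter> closure region) above"
  unfolding horosphere_eq
  by (rule strongly_stable_capillaryI[OF capillary_strip exhaustion_strip])
    (simp_all add: curvatures_strip surface_boundary_strip q_coeff_zero)

end

lemma slab_eq: "slab a b = tilted_slab.region ((a + b) / 2) ((b - a) / 2) 0" if "a < b"
proof -
  interpret tilted_slab "(a + b) / 2" "(b - a) / 2" 0 1 using that by unfold_locales auto
  show ?thesis by (auto simp: slab_def region_def abs_less_iff field_simps)
qed

lemma wedge_eq: "wedge \<theta> = tilted_slab.region 0 0 (1 / tan \<theta>)" if "0 < \<theta>" "\<theta> < pi / 2"
proof -
  interpret tilted_slab 0 0 "1 / tan \<theta>" 1 using tan_gt_zero[OF that] by unfold_locales auto
  show ?thesis by (auto simp: wedge_def region_def)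
qed

theorem theorem3p1:
  fixes \<tau> :: real
  assumes "\<tau> > 0"
  shows "(\<forall>\<tau>\<^sub>1 \<tau>\<^sub>2. \<tau>\<^sub>1 < \<tau>\<^sub>2 \<longrightarrow>
            strongly_stable_capillary (slab \<tau>\<^sub>1 \<tau>\<^sub>2)
              (horosphere \<tau> \<inter> closure (slab \<tau>\<^sub>1 \<tau>\<^sub>2)) (slab \<tau>\<^sub>1 \<tau>\<^sub>2 \<inter> {p. p $ 3 > \<tau>})) \<and>
         (\<forall>\<theta>. 0 < \<theta> \<and> \<theta> < pi / 2 \<longrightarrow>
            strongly_stable_capillary (wedge \<theta>)
              (horosphere \<tau> \<inter> closure (wedge \<theta>)) (wedge \<theta> \<inter> {p. p $ 3 > \<tau>}))"
proof (intro conjI allI impI)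
  fix a b :: real assume ab: "a < b"
  interpret tilted_slab "(a + b) / 2" "(b - a) / 2" 0 \<tau> using ab assms by unfold_locales auto
  show "strongly_stable_capillary (slab a b) (horosphere \<tau> \<inter> closure (slab a b)) (slab a b \<inter> {p. p $ 3 > \<tau>})"
    using strongly_stable unfolding above_def slab_eq[OF ab] .
next
  fix \<theta> :: real assume \<theta>: "0 < \<theta> \<and> \<theta> < pi / 2"
  interpret tilted_slab 0 0 "1 / tan \<theta>" \<tau>
    using \<theta> assms tan_gt_zero[of \<theta>] by unfold_locales auto
  show "strongly_stable_capillary (wedge \<theta>) (horosphere \<tau> \<inter> closure (wedge \<theta>)) (wedge \<theta> \<inter> {p. p $ 3 > \<tau>})"
    using strongly_stable \<theta> unfolding above_def by (simp add: wedge_eq)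
qed

end
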